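(* Let $K$ be a precubical set, $(\alpha,\beta)\in K_0\times K_0$ and $\ell>0$. The map \[ \coprod_{n\ge1}\mathcal{G}(\ell,n)\times\vec{N}^n_{\alpha,\beta}(K)\longrightarrow\vec{R}^\ell_{\alpha,\beta}(K),\qquad (\phi,\gamma)\mapsto\gamma\circ\phi, \] is a homeomorphism; its inverse sends $r$ to $(\widehat L(r),\,r\circ\widehat L(r)^{-1})$, where $\widehat L(r)(t)$ is the $L_1$-arc length of $r|_{[0,t]}$.
   Context: $\mathbf{Top}$ is the category of $\Delta$-generated spaces; spaces of maps carry the $\Delta$-kelleyfication of the compact-open topology and subsets of them the $\Delta$-kelleyfication of the relative topology. Precubical sets are presheaves on the box category $\square$ (objects $[n]=\{0,1\}^n$, maps generated by cofaces inserting $\alpha\in\{0,1\}$ at position $i$); $K_0$ is the set of vertices; $|K|_{geom}=\mathrm{colim}_{\square[n]\to K}[0,1]^n$; $|c|_{geom}:[0,1]^n\to|K|_{geom}$ for $c\in K_n$. A $d$-path of $[0,1]^n$ is a continuous map $[0,\ell]\to[0,1]^n$ nondecreasing in each coordinate, tame if its endpoints lie in $\{0,1\}^n$; a $d$-path of $K$ is a Moore composition (concatenation without rescaling) $(|c_1|_{geom}\circ\gamma_1)*\cdots*(|c_p|_{geom}\circ\gamma_p)$ of such, tame if the $\gamma_i$ can be chosen tame. A path is regular if it is constant on no interval $[a,b]$ with $a<b$. The $L_1$-arc length of a $d$-path $\gamma$ of $[0,1]^n$ between times $t\le t'$ is $\sum_i|\gamma_i(t')-\gamma_i(t)|$, extended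 additively to Moore compositions (well defined since cofaces preserve this metric). $\vec R^\ell_{\alpha,\beta}(K)$ is the space of nonconstant tame regular $d$-paths $[0,\ell]\to|K|_{geom}$ from $\alpha$ to $\beta$. A $d$-path $\gamma$ of length $n$ is natural if the $L_1$-arc length of $\gamma|_{[0,t]}$ equals $t$ for all $t$; $\vec N^n_{\alpha,\beta}(K)\subset\vec R^n_{\alpha,\beta}(K)$ is the subspace of natural ones ($n\ge1$ integer). $\mathcal G(\ell,n)$ is the space of nondecreasing homeomorphisms $[0,\ell]\to[0,n]$ with the compact-open topology. *)

theory Defs
  imports "HOL-Analysis.Analysis" "HOL-Homology.Simplices"
begin

definition simplex_top :: "nat \<Rightarrow> (nat \<Rightarrow> real) topology" where
  "simplex_top m = subtopology (powertop_real UNIV) (standard_simplex m)"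

definition dk :: "'a topology \<Rightarrow> 'a topology" where
  "dk X = topology (\<lambda>U. U \<subseteq> topspace X \<and>
      (\<forall>m \<sigma>. continuous_map (simplex_top m) X \<sigma> \<longrightarrow>
          openin (simplex_top m) {x \<in> standard_simplex m. \<sigma> x \<in> U}))"

definition cmaps :: "'a topology \<Rightarrow> 'b topology \<Rightarrow> ('a \<Rightarrow> 'b) set" where
  "cmaps X Y = {f \<in> extensional (topspace X). continuous_map X Y f}"

definition co_top :: "'a topology \<Rightarrow> 'b topology \<Rightarrow> ('a \<Rightarrow> 'b) topology" where
  "co_top X Y = topology_generated_by
     ({cmaps X Y} \<union> {{f \<in> cmaps X Y. f ` C \<subseteq> U} | C U. compactin X C \<and> openin Y U})"

definition quotient_top :: "'a topology \<Rightarrow> ('a \<times> 'a) set \<Rightarrow> 'a set topology" where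
  "quotient_top X r = topology (\<lambda>U. U \<subseteq> topspace X // r \<and> openin X (\<Union>U))"

text \<open>A precubical set: sets K n of n-cubes and face maps
  d n i a : K (n+1) -> K n (0 <= i <= n), i.e. K applied to the coface
  inserting a at position i, satisfying the precubical identities
  (dual to delta_j^b delta_i^a = delta_i^a delta_(j-1)^b for i < j).\<close>
definition precubical :: "(nat \<Rightarrow> 'a set) \<Rightarrow> (nat \<Rightarrow> nat \<Rightarrow> bool \<Rightarrow> 'a \<Rightarrow> 'a) \<Rightarrow> bool" where
  "precubical K d \<longleftrightarrow>
     (\<forall>n i a c. i \<le> n \<and> c \<in> K (Suc n) \<longrightarrow> d n i a c \<in> K n) \<and>
     (\<forall>n i j a b c. i < j \<and> j \<le> Suc n \<and> c \<in> K (Suc (Suc n)) \<longrightarrow>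
         d n i a (d (Suc n) j b c) = d n (j - 1) b (d (Suc n) i a c))"

definition cube :: "nat \<Rightarrow> (nat \<Rightarrow> real) set" where
  "cube n = {x. (\<forall>i<n. 0 \<le> x i \<and> x i \<le> 1) \<and> (\<forall>i\<ge>n. x i = 0)}"

definition cube_top :: "nat \<Rightarrow> (nat \<Rightarrow> real) topology" where
  "cube_top n = subtopology (powertop_real UNIV) (cube n)"

definition coface :: "nat \<Rightarrow> bool \<Rightarrow> (nat \<Rightarrow> real) \<Rightarrow> (nat \<Rightarrow> real)" where
  "coface i a x = (\<lambda>j. if j < i then x j else if j = i then (if a then 1 else 0) else x (j - 1))"

type_synonym 'a gpt = "(nat \<times> 'a \<times> (nat \<Rightarrow> real)) set"

definition geom_pre :: "(nat \<Rightarrow> 'a set) \<Rightarrow> (nat \<times> 'a \<times> (nat \<Rightarrow> real)) topology" where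
  "geom_pre K = sum_topology (\<lambda>n. prod_topology (discrete_topology (K n)) (cube_top n)) UNIV"

definition geom_gen :: "(nat \<Rightarrow> 'a set) \<Rightarrow> (nat \<Rightarrow> nat \<Rightarrow> bool \<Rightarrow> 'a \<Rightarrow> 'a)
     \<Rightarrow> ((nat \<times> 'a \<times> (nat \<Rightarrow> real)) \<times> (nat \<times> 'a \<times> (nat \<Rightarrow> real))) set" where
  "geom_gen K d = {((n, d n i a c, x), (Suc n, c, coface i a x)) | n i a c x.
       i \<le> n \<and> c \<in> K (Suc n) \<and> x \<in> cube n}"

definition geom_eq :: "(nat \<Rightarrow> 'a set) \<Rightarrow> (nat \<Rightarrow> nat \<Rightarrow> bool \<Rightarrow> 'a \<Rightarrow> 'a)
     \<Rightarrow> ((nat \<times> 'a \<times> (nat \<Rightarrow> real)) \<times> (nat \<times> 'a \<times> (nat \<Rightarrow> real))) set" where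
  "geom_eq K d = (geom_gen K d \<union> (geom_gen K d)\<inverse>)\<^sup>* \<inter> (topspace (geom_pre K) \<times> topspace (geom_pre K))"

definition geom :: "(nat \<Rightarrow> 'a set) \<Rightarrow> (nat \<Rightarrow> nat \<Rightarrow> bool \<Rightarrow> 'a \<Rightarrow> 'a) \<Rightarrow> 'a gpt topology" where
  "geom K d = quotient_top (geom_pre K) (geom_eq K d)"

definition cell_map :: "(nat \<Rightarrow> 'a set) \<Rightarrow> (nat \<Rightarrow> nat \<Rightarrow> bool \<Rightarrow> 'a \<Rightarrow> 'a)
     \<Rightarrow> nat \<Rightarrow> 'a \<Rightarrow> (nat \<Rightarrow> real) \<Rightarrow> 'a gpt" where
  "cell_map K d n c x = geom_eq K d `` {(n, c, x)}"

definition vertex_pt :: "(nat \<Rightarrow> 'a set) \<Rightarrow> (nat \<Rightarrow> nat \<Rightarrow> bool \<Rightarrow> 'a \<Rightarrow> 'a) \<Rightarrow> 'a \<Rightarrow> 'a gpt" where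
  "vertex_pt K d v = cell_map K d 0 v (\<lambda>_. 0)"

definition dpath_cube :: "nat \<Rightarrow> real \<Rightarrow> (real \<Rightarrow> nat \<Rightarrow> real) \<Rightarrow> bool" where
  "dpath_cube n l g \<longleftrightarrow> continuous_map (subtopology euclideanreal {0..l}) (cube_top n) g \<and>
     (\<forall>s t i. 0 \<le> s \<and> s \<le> t \<and> t \<le> l \<and> i < n \<longrightarrow> g s i \<le> g t i)"

definition tame_cube :: "nat \<Rightarrow> real \<Rightarrow> (real \<Rightarrow> nat \<Rightarrow> real) \<Rightarrow> bool" where
  "tame_cube n l g \<longleftrightarrow> (\<forall>i<n. g 0 i \<in> {0, 1} \<and> g l i \<in> {0, 1})"

definition moore_decomp :: "(nat \<Rightarrow> 'a set) \<Rightarrow> (nat \<Rightarrow> nat \<Rightarrow> bool \<Rightarrow> 'a \<Rightarrow> 'a) \<Rightarrow> real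
     \<Rightarrow> (real \<Rightarrow> 'a gpt) \<Rightarrow> nat \<Rightarrow> (nat \<Rightarrow> real) \<Rightarrow> (nat \<Rightarrow> nat) \<Rightarrow> (nat \<Rightarrow> 'a)
     \<Rightarrow> (nat \<Rightarrow> real \<Rightarrow> nat \<Rightarrow> real) \<Rightarrow> bool" where
  "moore_decomp K d l r p t ns cs gs \<longleftrightarrow> p \<ge> 1 \<and> t 0 = 0 \<and> t p = l \<and>
     (\<forall>k<p. t k < t (Suc k) \<and> cs k \<in> K (ns k) \<and>
        dpath_cube (ns k) (t (Suc k) - t k) (gs k) \<and>
        (\<forall>s\<in>{t k..t (Suc k)}. r s = cell_map K d (ns k) (cs k) (gs k (s - t k))))"

definition tame_dpath :: "(nat \<Rightarrow> 'a set) \<Rightarrow> (nat \<Rightarrow> nat \<Rightarrow> bool \<Rightarrow> 'a \<Rightarrow> 'a) \<Rightarrow> real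
     \<Rightarrow> (real \<Rightarrow> 'a gpt) \<Rightarrow> bool" where
  "tame_dpath K d l r \<longleftrightarrow> (\<exists>p t ns cs gs. moore_decomp K d l r p t ns cs gs \<and>
       (\<forall>k<p. tame_cube (ns k) (t (Suc k) - t k) (gs k)))"

definition regular_path :: "real \<Rightarrow> (real \<Rightarrow> 'b) \<Rightarrow> bool" where
  "regular_path l r \<longleftrightarrow> \<not> (\<exists>a b. 0 \<le> a \<and> a < b \<and> b \<le> l \<and> (\<forall>s\<in>{a..b}. r s = r a))"

definition nonconstant_path :: "real \<Rightarrow> (real \<Rightarrow> 'b) \<Rightarrow> bool" where
  "nonconstant_path l r \<longleftrightarrow> (\<exists>s\<in>{0..l}. \<exists>s'\<in>{0..l}. r s \<noteq> r s')"

text \<open>L1-arc length of r restricted to [0,u], computed along a (chosen) Moore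
  decomposition; the paper notes it does not depend on the decomposition.\<close>
definition arclen :: "(nat \<Rightarrow> 'a set) \<Rightarrow> (nat \<Rightarrow> nat \<Rightarrow> bool \<Rightarrow> 'a \<Rightarrow> 'a) \<Rightarrow> real
     \<Rightarrow> (real \<Rightarrow> 'a gpt) \<Rightarrow> real \<Rightarrow> real" where
  "arclen K d l r u = (case (SOME (p, t, ns, cs, gs). moore_decomp K d l r p t ns cs gs) of
     (p, t, ns, cs, gs) \<Rightarrow>
       (\<Sum>k<p. if u \<le> t k then 0
               else (\<Sum>i<ns k. gs k (min u (t (Suc k)) - t k) i - gs k 0 i)))"

definition Lhat :: "(nat \<Rightarrow> 'a set) \<Rightarrow> (nat \<Rightarrow> nat \<Rightarrow> bool \<Rightarrow> 'a \<Rightarrow> 'a) \<Rightarrow> real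
     \<Rightarrow> (real \<Rightarrow> 'a gpt) \<Rightarrow> real \<Rightarrow> real" where
  "Lhat K d l r = restrict (arclen K d l r) {0..l}"

definition path_top :: "(nat \<Rightarrow> 'a set) \<Rightarrow> (nat \<Rightarrow> nat \<Rightarrow> bool \<Rightarrow> 'a \<Rightarrow> 'a) \<Rightarrow> real
     \<Rightarrow> (real \<Rightarrow> 'a gpt) topology" where
  "path_top K d l = dk (co_top (subtopology euclideanreal {0..l}) (geom K d))"

definition R_set :: "(nat \<Rightarrow> 'a set) \<Rightarrow> (nat \<Rightarrow> nat \<Rightarrow> bool \<Rightarrow> 'a \<Rightarrow> 'a) \<Rightarrow> real
     \<Rightarrow> 'a \<Rightarrow> 'a \<Rightarrow> (real \<Rightarrow> 'a gpt) set" where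
  "R_set K d l a b = {r \<in> extensional {0..l}. tame_dpath K d l r \<and> regular_path l r \<and>
      nonconstant_path l r \<and> r 0 = vertex_pt K d a \<and> r l = vertex_pt K d b}"

definition R_top :: "(nat \<Rightarrow> 'a set) \<Rightarrow> (nat \<Rightarrow> nat \<Rightarrow> bool \<Rightarrow> 'a \<Rightarrow> 'a) \<Rightarrow> real
     \<Rightarrow> 'a \<Rightarrow> 'a \<Rightarrow> (real \<Rightarrow> 'a gpt) topology" where
  "R_top K d l a b = dk (subtopology (path_top K d l) (R_set K d l a b))"

definition N_set :: "(nat \<Rightarrow> 'a set) \<Rightarrow> (nat \<Rightarrow> nat \<Rightarrow> bool \<Rightarrow> 'a \<Rightarrow> 'a) \<Rightarrow> nat
     \<Rightarrow> 'a \<Rightarrow> 'a \<Rightarrow> (real \<Rightarrow> 'a gpt) set" where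
  "N_set K d n a b = {g \<in> R_set K d (real n) a b. \<forall>t\<in>{0..real n}. arclen K d (real n) g t = t}"

definition N_top :: "(nat \<Rightarrow> 'a set) \<Rightarrow> (nat \<Rightarrow> nat \<Rightarrow> bool \<Rightarrow> 'a \<Rightarrow> 'a) \<Rightarrow> nat
     \<Rightarrow> 'a \<Rightarrow> 'a \<Rightarrow> (real \<Rightarrow> 'a gpt) topology" where
  "N_top K d n a b = dk (subtopology (R_top K d (real n) a b) (N_set K d n a b))"

definition G_set :: "real \<Rightarrow> nat \<Rightarrow> (real \<Rightarrow> real) set" where
  "G_set l n = {f \<in> extensional {0..l}.
      homeomorphic_map (subtopology euclideanreal {0..l}) (subtopology euclideanreal {0..real n}) f \<and>
      mono_on {0..l} f}"

definition G_top :: "real \<Rightarrow> nat \<Rightarrow> (real \<Rightarrow> real) topology" where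
  "G_top l n = subtopology (co_top (subtopology euclideanreal {0..l})
                   (subtopology euclideanreal {0..real n})) (G_set l n)"

text \<open>The coproduct over n >= 1 of G(l,n) x N^n (products taken in Top, i.e.
  Delta-kelleyfied).\<close>
definition src_top :: "(nat \<Rightarrow> 'a set) \<Rightarrow> (nat \<Rightarrow> nat \<Rightarrow> bool \<Rightarrow> 'a \<Rightarrow> 'a) \<Rightarrow> real
     \<Rightarrow> 'a \<Rightarrow> 'a \<Rightarrow> (nat \<times> (real \<Rightarrow> real) \<times> (real \<Rightarrow> 'a gpt)) topology" where
  "src_top K d l a b = sum_topology (\<lambda>n. dk (prod_topology (G_top l n) (N_top K d n a b))) {1..}"

definition reparam :: "real \<Rightarrow> (nat \<times> (real \<Rightarrow> real) \<times> (real \<Rightarrow> 'b)) \<Rightarrow> (real \<Rightarrow> 'b)" where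
  "reparam l = (\<lambda>(n, f, g). restrict (g \<circ> f) {0..l})"

end

theory Submission
  imports Defs
begin

text \<open>
  Inserting a coordinate 0 or 1 changes the coordinate sum of a point by an integer, so the
  coordinate sum modulo 1 is a continuous map from the realization to the circle. Along a
  directed path the \<open>L\<^sub>1\<close>-arc length is nothing but the lift of the resulting circle-valued path. Uniqueness of
  lifts makes arc length independent of the decomposition and compatible with reparametrization;
  continuity of lifting makes it jointly continuous in path and time. All topologies involved
  are tested on continuous maps from simplices, and on a compact interval such a map into a path
  space is the same as a jointly continuous map, so both the bijection and its inverse are continuous.
\<close>

section \<open>Kelleyfication and the compact-open topology\<close>

text \<open>\<open>arclen\<close> is computed along a decomposition picked by \<open>SOME\<close>,
  so nothing in its definition relates the choices made for \<open>r\<close>, for a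
  reparametrization of \<open>r\<close>, or for neighbouring paths. Comparing decompositions would
  require common refinements and a study of which cubes meet in the quotient. Uniqueness of lifts
  replaces all of this: a single continuous map out of the realization suffices. The disjoint union
  over \<open>n\<close> comes from the same coordinate. Vertices have phase 1, so the total length
  is an integer, and a continuous integer-valued function is constant on a simplex; hence every
  continuous map from a simplex to the path space (a probe) stays in one summand. Regularity enters
  where arc length must be invertible: a stretch of zero length forces every coordinate of a cube
  path to stand still. The inverse of arc length depends continuously on the path by order alone,
  because for strictly increasing functions \<open>g x s < c\<close> means
  \<open>s < f x c\<close>.\<close>

lemma topspace_simplex_top [simp]: "topspace (simplex_top m) = standard_simplex m"
  by (simp add: simplex_top_def)

lemma connected_space_simplex_top: "connected_space (simplex_top m)"
  using connectedin_standard_simplex [of m] by (simp add: simplex_top_def connectedin_def)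

lemma istopology_dk:
  "istopology (\<lambda>U. U \<subseteq> topspace X \<and>
      (\<forall>m \<sigma>. continuous_map (simplex_top m) X \<sigma> \<longrightarrow>
          openin (simplex_top m) {x \<in> standard_simplex m. \<sigma> x \<in> U}))"
proof -
  have Int: "{x \<in> standard_simplex m. \<sigma> x \<in> S \<inter> T}
      = {x \<in> standard_simplex m. \<sigma> x \<in> S} \<inter> {x \<in> standard_simplex m. \<sigma> x \<in> T}"
    for m and \<sigma> :: "(nat \<Rightarrow> real) \<Rightarrow> 'a" and S T
    by auto
  have Un: "{x \<in> standard_simplex m. \<sigma> x \<in> \<Union>\<K>}
      = (\<Union>S\<in>\<K>. {x \<in> standard_simplex m. \<sigma> x \<in> S})"
    for m and \<sigma> :: "(nat \<Rightarrow> real) \<Rightarrow> 'a" and \<K>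
    by auto
  show ?thesis
    unfolding istopology_def Int Un by (auto intro!: openin_Union)
qed

lemma openin_dk:
  "openin (dk X) U \<longleftrightarrow> U \<subseteq> topspace X \<and>
      (\<forall>m \<sigma>. continuous_map (simplex_top m) X \<sigma> \<longrightarrow>
          openin (simplex_top m) {x \<in> standard_simplex m. \<sigma> x \<in> U})"
  by (simp add: dk_def istopology_dk)

lemma openin_imp_openin_dk: "openin X U \<Longrightarrow> openin (dk X) U"
  by (auto simp: openin_dk openin_subset dest: openin_continuous_map_preimage)

lemma topspace_dk [simp]: "topspace (dk X) = topspace X"
  by (metis openin_dk openin_imp_openin_dk openin_subset openin_topspace subset_antisym)

text \<open>Kelleyfication adds a set to the topology only if its preimages under all probes are
  already open, so the probes stay the same. This strips every nested \<open>dk\<close> from the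
  path spaces.\<close>

lemma continuous_map_simplex_dk [simp]:
  "continuous_map (simplex_top m) (dk X) \<sigma> \<longleftrightarrow> continuous_map (simplex_top m) X \<sigma>"
proof
  assume "continuous_map (simplex_top m) (dk X) \<sigma>"
  then show "continuous_map (simplex_top m) X \<sigma>"
    by (auto simp: continuous_map_def openin_imp_openin_dk)
next
  assume "continuous_map (simplex_top m) X \<sigma>"
  then show "continuous_map (simplex_top m) (dk X) \<sigma>"
    by (auto simp: continuous_map_def openin_dk)
qed

text \<open>\<open>dk X\<close> carries the final topology with respect to all probes of
  \<open>X\<close>, so continuity out of it can be tested on them.\<close>

lemma continuous_map_from_dk:
  assumes probe: "\<And>m \<sigma>. continuous_map (simplex_top m) X \<sigma>
                  \<Longrightarrow> continuous_map (simplex_top m) Y (\<lambda>x. f (\<sigma> x))"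
  shows "continuous_map (dk X) Y f"
  unfolding continuous_map_def
proof (intro conjI allI impI)
  show "f \<in> topspace (dk X) \<rightarrow> topspace Y"
  proof
    fix x assume "x \<in> topspace (dk X)"
    \<comment> \<open>A constant probe on the 0-simplex singles out the point
      \<open>x\<close>.\<close>
    then have "continuous_map (simplex_top 0) Y (\<lambda>_. f x)"
      by (intro probe) simp
    from continuous_map_funspace [OF this] show "f x \<in> topspace Y"
      using nonempty_standard_simplex [of 0] by fastforce
  qed
  fix U assume U: "openin Y U"
  have "openin (simplex_top m) {x \<in> standard_simplex m. \<sigma> x \<in> {x \<in> topspace X. f x \<in> U}}"
    if \<sigma>: "continuous_map (simplex_top m) X \<sigma>" for m \<sigma>
  proof -
    have "{x \<in> standard_simplex m. \<sigma> x \<in> {x \<in> topspace X. f x \<in> U}}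
        = {x \<in> topspace (simplex_top m). f (\<sigma> x) \<in> U}"
      using continuous_map_funspace [OF \<sigma>] by auto
    then show ?thesis
      using openin_continuous_map_preimage [OF probe [OF \<sigma>] U] by simp
  qed
  then show "openin (dk X) {x \<in> topspace (dk X). f x \<in> U}"
    by (auto simp: openin_dk)
qed

lemma continuous_map_from_sum_topology:
  assumes "\<And>i. i \<in> I \<Longrightarrow> continuous_map (X i) Y (\<lambda>x. f (i, x))"
  shows "continuous_map (sum_topology X I) Y f"
  unfolding continuous_map_def
proof (intro conjI allI impI)
  show "f \<in> topspace (sum_topology X I) \<rightarrow> topspace Y"
    using continuous_map_funspace [OF assms] by force
  fix U assume U: "openin Y U"
  have "{x. (i, x) \<in> {x \<in> topspace (sum_topology X I). f x \<in> U}} = {x \<in> topspace (X i). f (i, x) \<in> U}"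
    if "i \<in> I" for i
    using that by auto
  then show "openin (sum_topology X I) {x \<in> topspace (sum_topology X I). f x \<in> U}"
    using openin_continuous_map_preimage [OF assms U] by (auto simp: openin_sum_topology)
qed

section \<open>Exponential law for the compact-open topology\<close>

lemma topspace_co_top [simp]: "topspace (co_top X Y) = cmaps X Y"
  by (auto simp: co_top_def topology_generated_by_topspace)

text \<open>Compactness of \<open>C\<close> is the reason: if \<open>{x} \<times> C\<close> is
  mapped into \<open>U\<close>, the tube lemma thickens \<open>x\<close> to a neighbourhood whose
  product with \<open>C\<close> still goes into \<open>U\<close>. Extensionality is demanded since
  \<open>cmaps\<close> consists of extensional functions.\<close>

lemma continuous_map_into_co_top:
  assumes ext: "\<And>x. x \<in> topspace T \<Longrightarrow> f x \<in> extensional (topspace X)"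
    and cont: "continuous_map (prod_topology T X) Y (\<lambda>(x, s). f x s)"
  shows "continuous_map T (co_top X Y) f"
proof -
  have f: "f x \<in> cmaps X Y" if x: "x \<in> topspace T" for x
  proof -
    have "continuous_map X (prod_topology T X) (\<lambda>s. (x, s))"
      using x by (simp add: continuous_map_pairedI)
    from continuous_map_compose [OF this cont] show ?thesis
      using ext [OF x] by (simp add: cmaps_def o_def)
  qed
  have "openin T (f -` {g \<in> cmaps X Y. g ` C \<subseteq> U} \<inter> topspace T)"
    if C: "compactin X C" and U: "openin Y U" for C U
  proof (subst openin_subopen, intro ballI)
    fix x assume x: "x \<in> f -` {g \<in> cmaps X Y. g ` C \<subseteq> U} \<inter> topspace T"
    let ?W = "{z \<in> topspace (prod_topology T X). (case z of (x, s) \<Rightarrow> f x s) \<in> U}"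
    have W: "openin (prod_topology T X) ?W"
      by (rule openin_continuous_map_preimage [OF cont U])
    have "{x} \<times> C \<subseteq> ?W"
      using x compactin_subset_topspace [OF C] by auto
    then obtain V V' where V: "openin T V" "openin X V'" "x \<in> V" "C \<subseteq> V'" "V \<times> V' \<subseteq> ?W"
      using tube_lemma_right [OF W C, of x] x by auto
    have "V \<subseteq> f -` {g \<in> cmaps X Y. g ` C \<subseteq> U} \<inter> topspace T"
    proof
      fix y assume y: "y \<in> V"
      then have "(y, s) \<in> ?W" if "s \<in> C" for s
        using V that by (meson SigmaI subsetD)
      then show "y \<in> f -` {g \<in> cmaps X Y. g ` C \<subseteq> U} \<inter> topspace T"
        using f y openin_subset [OF V(1)] by auto
    qed
    with V show "\<exists>V. openin T V \<and> x \<in> V \<and> V \<subseteq> f -` {g \<in> cmaps X Y. g ` C \<subseteq> U} \<inter> topspace T"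
      by blast
  qed
  moreover have "openin T (f -` cmaps X Y \<inter> topspace T)"
  proof -
    have "f -` cmaps X Y \<inter> topspace T = topspace T"
      using f by auto
    then show ?thesis by simp
  qed
  ultimately show ?thesis
    unfolding co_top_def using f by (intro continuous_on_generated_topo) auto
qed

text \<open>Local compactness of \<open>X\<close> drives this converse: a compact \<open>C\<close>
  around \<open>s\<close> inside the preimage of \<open>U\<close> turns membership of
  \<open>f x\<close> in the subbasic set for \<open>C\<close> and \<open>U\<close> into control over
  all nearby pairs.\<close>

lemma continuous_map_from_co_top:
  assumes X: "neighbourhood_base_of (compactin X) X"
    and f: "continuous_map T (co_top X Y) f"
  shows "continuous_map (prod_topology T X) Y (\<lambda>(x, s). f x s)"
proof -
  have fx: "continuous_map X Y (f x)" if "x \<in> topspace T" for x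
    using continuous_map_funspace [OF f] that by (auto simp: cmaps_def)
  have "openin (prod_topology T X) {z \<in> topspace (prod_topology T X). (case z of (x, s) \<Rightarrow> f x s) \<in> U}"
    (is "openin _ ?P") if U: "openin Y U" for U
  proof (subst openin_subopen, intro ballI)
    fix z assume z: "z \<in> ?P"
    then obtain x s where xs: "z = (x, s)" "x \<in> topspace T" "s \<in> topspace X" "f x s \<in> U"
      by auto
    let ?V = "{s \<in> topspace X. f x s \<in> U}"
    have "openin X ?V"
      by (rule openin_continuous_map_preimage [OF fx [OF xs(2)] U])
    then obtain V C where V: "openin X V" "compactin X C" "s \<in> V" "V \<subseteq> C" "C \<subseteq> ?V"
      using X xs unfolding neighbourhood_base_of by (metis (mono_tags, lifting) mem_Collect_eq)
    let ?W = "{x \<in> topspace T. f x \<in> {g \<in> cmaps X Y. g ` C \<subseteq> U}}"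
    have "openin (co_top X Y) {g \<in> cmaps X Y. g ` C \<subseteq> U}"
      unfolding co_top_def using V U by (intro topology_generated_by_Basis) auto
    then have W: "openin T ?W"
      by (rule openin_continuous_map_preimage [OF f])
    have "openin (prod_topology T X) (?W \<times> V)"
      using W V by (simp add: openin_prod_Times_iff)
    moreover have "z \<in> ?W \<times> V"
      using xs V fx continuous_map_funspace [OF f] by auto
    moreover have "?W \<times> V \<subseteq> ?P"
    proof clarify
      fix x' s' assume "x' \<in> topspace T" "f x' ` C \<subseteq> U" "s' \<in> V"
      then show "(x', s') \<in> topspace (prod_topology T X) \<and> f x' s' \<in> U"
        using V(4) openin_subset [OF V(1)] by auto
    qed
    ultimately show "\<exists>T'. openin (prod_topology T X) T' \<and> z \<in> T' \<and> T' \<subseteq> ?P"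
      by blast
  qed
  moreover have "(\<lambda>(x, s). f x s) \<in> topspace (prod_topology T X) \<rightarrow> topspace Y"
    using continuous_map_funspace [OF fx] by auto
  ultimately show ?thesis
    unfolding continuous_map_def by blast
qed

lemma neighbourhood_base_compactin_interval:
  "neighbourhood_base_of (compactin (subtopology euclideanreal {u..v})) (subtopology euclideanreal {u..v})"
  by (subst locally_compact_space_neighbourhood_base [symmetric])
    (auto simp: Hausdorff_space_subtopology compact_space_subtopology
        intro!: compact_imp_locally_compact_space)

lemma continuous_map_co_top_interval:
  "continuous_map T (co_top (subtopology euclideanreal {u..v}) Y) f \<longleftrightarrow>
     (\<forall>x \<in> topspace T. f x \<in> extensional {u..v}) \<and>
     continuous_map (prod_topology T (subtopology euclideanreal {u..v})) Y (\<lambda>(x, s). f x s)"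
  (is "?L \<longleftrightarrow> ?R")
proof
  assume L: ?L
  then show ?R
    using continuous_map_from_co_top [OF neighbourhood_base_compactin_interval L]
      continuous_map_funspace [OF L] by (auto simp: cmaps_def)
next
  assume ?R then show ?L
    by (intro continuous_map_into_co_top) auto
qed

section \<open>Lifting to the line\<close>

text \<open>Leaving the interval around 0 would force \<open>\<bar>D s\<bar> = e\<close> at some
  time up to \<open>t\<close> by the intermediate value theorem, and there the cosine takes exactly
  the excluded value. This keeps two lifts on the same sheet.\<close>

lemma cos_lift_bound:
  fixes D :: "real \<Rightarrow> real"
  assumes D: "continuous_on {0..l} D" "D 0 = 0"
    and e: "0 < e" "e \<le> 1/2"
    and cos: "\<And>t. t \<in> {0..l} \<Longrightarrow> cos (2 * pi * e) < cos (2 * pi * D t)"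
    and t: "t \<in> {0..l}"
  shows "\<bar>D t\<bar> < e"
proof (rule ccontr)
  assume "\<not> \<bar>D t\<bar> < e"
  moreover have "continuous_on {0..t} (\<lambda>s. \<bar>D s\<bar>)"
    using t by (intro continuous_intros continuous_on_subset [OF D(1)]) auto
  ultimately obtain s where s: "0 \<le> s" "s \<le> t" "\<bar>D s\<bar> = e"
    using IVT' [of "\<lambda>s. \<bar>D s\<bar>" 0 e t] D e t by auto
  then have "cos (2 * pi * D s) = cos (2 * pi * e)"
    by (cases "D s \<ge> 0") auto
  then show False
    using cos [of s] s t by auto
qed

lemma cis_lift_unique:
  fixes f g :: "real \<Rightarrow> real"
  assumes f: "continuous_on {0..l} f" "f 0 = 0" and g: "continuous_on {0..l} g" "g 0 = 0"
    and eq: "\<And>t. t \<in> {0..l} \<Longrightarrow> cis (2 * pi * f t) = cis (2 * pi * g t)"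
    and t: "t \<in> {0..l}"
  shows "f t = g t"
proof (rule ccontr)
  assume ne: "f t \<noteq> g t"
  \<comment> \<open>The cap 1/2 keeps \<open>2 * pi * e\<close> in the range where the cosine
    decreases strictly, so its value is below 1; the other bound makes
    \<open>\<bar>f t - g t\<bar> < e\<close> absurd.\<close>
  define e where "e = min (1/2) \<bar>f t - g t\<bar>"
  have e: "0 < e" "e \<le> 1/2" "e \<le> \<bar>f t - g t\<bar>"
    unfolding e_def using ne by linarith+
  have 1: "cos (2 * pi * (f s - g s)) = 1" if "s \<in> {0..l}" for s
  proof -
    have "cis (2 * pi * (f s - g s)) = cis (2 * pi * f s) / cis (2 * pi * g s)"
      by (simp add: cis_divide algebra_simps)
    then have "cis (2 * pi * (f s - g s)) = 1"
      using eq [OF that] by simp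
    then show ?thesis
      by (metis cis.simps(1) one_complex.simps(1))
  qed
  have "cos (2 * pi * e) < cos 0"
    using e by (intro cos_monotone_0_pi) auto
  then have "\<bar>f t - g t\<bar> < e"
    using f g e t 1 by (intro cos_lift_bound [of l "\<lambda>t. f t - g t"]) (auto intro: continuous_on_diff)
  then show False using e by linarith
qed

text \<open>On the compact interval, nearby circle-valued paths are uniformly close, and the difference of
  their lifts cannot reach a small \<open>e\<close> without the cosine of the difference dropping.\<close>
lemma continuous_map_cis_lift:
  fixes L :: "'c \<Rightarrow> real \<Rightarrow> real"
  assumes q: "continuous_map (prod_topology T (subtopology euclideanreal {0..l})) euclidean q"
    and L: "\<And>x. x \<in> topspace T \<Longrightarrow> continuous_on {0..l} (L x)"
      "\<And>x. x \<in> topspace T \<Longrightarrow> L x 0 = 0"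
    and lift: "\<And>x t. x \<in> topspace T \<Longrightarrow> t \<in> {0..l} \<Longrightarrow> q (x, t) = cis (2 * pi * L x t)"
  shows "continuous_map (prod_topology T (subtopology euclideanreal {0..l})) euclideanreal
    (\<lambda>(x, t). L x t)"
  unfolding continuous_map_atin
proof
  let ?I = "subtopology euclideanreal {0..l}"
  fix z assume "z \<in> topspace (prod_topology T ?I)"
  then obtain x t where z: "z = (x, t)" "x \<in> topspace T" "t \<in> {0..l}"
    by auto
  have "\<forall>\<^sub>F y in atin (prod_topology T ?I) z. dist (case y of (x, t) \<Rightarrow> L x t) (L x t) < e"
    if e: "0 < e" for e :: real
  proof -
    define e' where "e' = min (1/2) (e/2)"
    have e': "0 < e'" "e' \<le> 1/2" "e' \<le> e/2"
      using e by (auto simp: e'_def)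
    \<comment> \<open>\<open>F\<close> is the cosine of the difference between the lifts over a
      variable point and over the fixed \<open>x\<close>. It is written through \<open>q\<close>
      because continuity of \<open>L\<close> in its first argument is what is being proved.\<close>
    define F where "F = (\<lambda>z. Re (q z * cnj (cis (2 * pi * L x (snd z)))))"
    have F: "F (y, s) = cos (2 * pi * (L y s - L x s))" if "y \<in> topspace T" "s \<in> {0..l}" for y s
      using that by (simp add: F_def lift cos_diff algebra_simps)
    let ?W = "{z \<in> topspace (prod_topology T ?I). F z \<in> {cos (2 * pi * e')<..}}"
    have "continuous_map (prod_topology T ?I) euclideanreal (\<lambda>z. L x (snd z))"
      using L(1) [OF z(2)] continuous_map_compose [OF continuous_map_snd [of T ?I], of euclideanreal "L x"]
      by (simp add: o_def)
    then have "continuous_map (prod_topology T ?I) euclidean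
        (\<lambda>z. q z * cnj (cis (2 * pi * L x (snd z))))"
      using q unfolding continuous_map_atin limitin_canonical_iff
      by (auto intro!: tendsto_intros)
    from continuous_map_compose [OF this, of euclideanreal Re]
    have "continuous_map (prod_topology T ?I) euclideanreal F"
      by (simp add: F_def o_def continuous_on_Re)
    then have W: "openin (prod_topology T ?I) ?W"
      by (rule openin_continuous_map_preimage) auto
    have "cos (2 * pi * e') < cos 0"
      using e' by (intro cos_monotone_0_pi) auto
    then have "{x} \<times> {0..l} \<subseteq> ?W"
      using z by (auto simp: F)
    then obtain U V where U: "openin T U" "x \<in> U" "{0..l} \<subseteq> V" "U \<times> V \<subseteq> ?W"
      using tube_lemma_right [OF W, of "{0..l}" x] z by (auto simp: compactin_subtopology)
    have close: "\<bar>L y s - L x s\<bar> < e'" if y: "y \<in> U" and s: "s \<in> {0..l}" for y s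
    proof (rule cos_lift_bound [of l "\<lambda>s. L y s - L x s"])
      have yT: "y \<in> topspace T"
        using U(1) y openin_subset by blast
      show "continuous_on {0..l} (\<lambda>s. L y s - L x s)"
        using L yT z by (intro continuous_intros) auto
      show "L y 0 - L x 0 = 0"
        using L yT z by auto
      show "cos (2 * pi * e') < cos (2 * pi * (L y t - L x t))" if "t \<in> {0..l}" for t
      proof -
        have "(y, t) \<in> ?W" using U that y by blast
        then show ?thesis using F [OF yT that] by auto
      qed
    qed (use e' s in auto)
    \<comment> \<open>The error splits into \<open>L y s - L x s\<close>, bounded by
      \<open>close\<close> uniformly in \<open>s\<close>, and \<open>L x s - L x t\<close>, bounded
      by continuity of the single path \<open>L x\<close>.\<close>
    let ?V' = "{s \<in> topspace ?I. L x s \<in> ball (L x t) (e/2)}"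
    have "openin ?I ?V'"
      by (rule openin_continuous_map_preimage [where Y = euclideanreal]) (use L(1) [OF z(2)] in auto)
    then have "openin (prod_topology T ?I) (U \<times> ?V')"
      using U by (simp add: openin_prod_Times_iff)
    moreover have "z \<in> U \<times> ?V'"
      using z U e by auto
    moreover have "dist (L y s) (L x t) < e" if "y \<in> U" "s \<in> ?V'" for y s
      using close [of y s] that e' by (auto simp: dist_real_def abs_if split: if_splits)
    ultimately show ?thesis
      unfolding eventually_atin by (intro disjI2 exI [of _ "U \<times> ?V'"]) auto
  qed
  then show "limitin euclideanreal (\<lambda>(x, t). L x t) (case z of (x, t) \<Rightarrow> L x t)
      (atin (prod_topology T ?I) z)"
    using z by (simp add: tendsto_iff)
qed

text \<open>Strict monotonicity moves the inverse to the other side: \<open>g x s < c\<close> holds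
  iff \<open>s < f x c\<close>, an open condition on \<open>(x, s)\<close> since \<open>f\<close> is
  jointly continuous. Open half-lines suffice to test continuity into the reals.\<close>

lemma continuous_map_inverse_reparam:
  fixes f g :: "'c \<Rightarrow> real \<Rightarrow> real"
  assumes f: "continuous_map (prod_topology T (subtopology euclideanreal {u..v})) euclideanreal
      (\<lambda>(x, t). f x t)"
    and mono: "\<And>x. x \<in> topspace T \<Longrightarrow> strict_mono_on {u..v} (f x)"
    and g: "\<And>x s. x \<in> topspace T \<Longrightarrow> s \<in> {u'..v'} \<Longrightarrow> g x s \<in> {u..v} \<and> f x (g x s) = s"
  shows "continuous_map (prod_topology T (subtopology euclideanreal {u'..v'}))
      (subtopology euclideanreal {u..v}) (\<lambda>(x, s). g x s)"
proof -
  let ?J = "subtopology euclideanreal {u'..v'}"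
  have slice: "continuous_map (prod_topology T ?J) euclideanreal (\<lambda>z. f (fst z) c)"
    if "c \<in> {u..v}" for c
  proof -
    have "continuous_map (prod_topology T ?J) (prod_topology T (subtopology euclideanreal {u..v}))
        (\<lambda>z. (fst z, c))"
      using that by (auto intro!: continuous_map_pairedI continuous_map_fst)
    from continuous_map_compose [OF this f] show ?thesis
      by (simp add: o_def)
  qed
  have proj: "continuous_map (prod_topology T ?J) euclideanreal snd"
    using continuous_map_into_fulltopology continuous_map_snd by blast
  have range: "g (fst z) (snd z) \<in> {u..v}" if "z \<in> topspace (prod_topology T ?J)" for z
    using g that by (cases z) simp
  have less: "g x s < c \<longleftrightarrow> s < f x c" and greater: "c < g x s \<longleftrightarrow> f x c < s"
    if "x \<in> topspace T" "s \<in> {u'..v'}" "c \<in> {u..v}" for x s c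
    using strict_mono_on_less [OF mono [OF that(1)], of "g x s" c]
      strict_mono_on_less [OF mono [OF that(1)], of c "g x s"] g [OF that(1,2)] that(3) by auto
  have "openin (prod_topology T ?J) {z \<in> topspace (prod_topology T ?J). g (fst z) (snd z) < c}" for c
  proof (cases "c \<in> {u..v}")
    case True
    have eq: "{z \<in> topspace (prod_topology T ?J). g (fst z) (snd z) < c}
        = {z \<in> topspace (prod_topology T ?J). f (fst z) c - snd z \<in> {0<..}}"
      using less [OF _ _ True] by auto
    show ?thesis
      unfolding eq by (rule openin_continuous_map_preimage
          [OF continuous_map_diff [OF slice [OF True] proj]]) simp
  next
    case False
    \<comment> \<open>A bound \<open>c\<close> outside \<open>{u..v}\<close> cannot be fed to
      \<open>f\<close>, but then all values of \<open>g\<close> lie on the same side of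
      \<open>c\<close>.\<close>
    have "g (fst z) (snd z) < c \<longleftrightarrow> v < c" if "z \<in> topspace (prod_topology T ?J)" for z
      using range [OF that] False by auto
    then have "{z \<in> topspace (prod_topology T ?J). g (fst z) (snd z) < c}
        = (if v < c then topspace (prod_topology T ?J) else {})"
      by auto
    then show ?thesis
      by (simp only: openin_empty openin_topspace split: if_split) simp
  qed
  moreover have "openin (prod_topology T ?J) {z \<in> topspace (prod_topology T ?J). c < g (fst z) (snd z)}" for c
  proof (cases "c \<in> {u..v}")
    case True
    have eq: "{z \<in> topspace (prod_topology T ?J). c < g (fst z) (snd z)}
        = {z \<in> topspace (prod_topology T ?J). snd z - f (fst z) c \<in> {0<..}}"
      using greater [OF _ _ True] by auto
    show ?thesis
      unfolding eq by (rule openin_continuous_map_preimage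
          [OF continuous_map_diff [OF proj slice [OF True]]]) simp
  next
    case False
    have "c < g (fst z) (snd z) \<longleftrightarrow> c < u" if "z \<in> topspace (prod_topology T ?J)" for z
      using range [OF that] False by auto
    then have "{z \<in> topspace (prod_topology T ?J). c < g (fst z) (snd z)}
        = (if c < u then topspace (prod_topology T ?J) else {})"
      by auto
    then show ?thesis
      by (simp only: openin_empty openin_topspace split: if_split) simp
  qed
  ultimately have "continuous_map (prod_topology T ?J) euclideanreal (\<lambda>(x, s). g x s)"
    by (simp add: continuous_map_upper_lower_semicontinuous_lt case_prod_unfold)
  then show ?thesis
    using g by (auto simp: continuous_map_in_subtopology)
qed

section \<open>The circle coordinate on the realization\<close>

definition geom_phase :: "nat \<times> 'a \<times> (nat \<Rightarrow> real) \<Rightarrow> complex" where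
  "geom_phase = (\<lambda>(n, c, x). cis (2 * pi * (\<Sum>i<n. x i)))"

text \<open>The representative is arbitrary; on an equivalence class the phase does not depend on
  it, because each generating identification changes the coordinate sum by 0 or 1.\<close>

definition geom_circle :: "'a gpt \<Rightarrow> complex" where
  "geom_circle C = geom_phase (SOME z. z \<in> C)"

lemma sum_coface:
  assumes "i \<le> n"
  shows "(\<Sum>j<Suc n. coface i a x j) = (\<Sum>j<n. x j) + (if a then 1 else 0)"
  using assms
proof (induction n)
  case (Suc n)
  show ?case
  proof (cases "i = Suc n")
    case True
    then have "(\<Sum>j<Suc n. coface i a x j) = (\<Sum>j<Suc n. x j)"
      by (intro sum.cong) (auto simp: coface_def)
    then show ?thesis
      using True by (simp add: coface_def)
  next
    case False
    then show ?thesis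
      using Suc by (simp add: coface_def)
  qed
qed (simp add: coface_def)

lemma geom_phase_gen: "(y, z) \<in> geom_gen K d \<Longrightarrow> geom_phase y = geom_phase z"
proof -
  have "cis (2 * pi * (s + 1)) = cis (2 * pi * s)" for s
    by (simp add: distrib_left flip: cis_mult)
  then show "(y, z) \<in> geom_gen K d \<Longrightarrow> geom_phase y = geom_phase z"
    by (auto simp: geom_gen_def geom_phase_def sum_coface simp del: sum.lessThan_Suc)
qed

lemma geom_phase_eq:
  assumes "(y, z) \<in> geom_eq K d"
  shows "geom_phase y = geom_phase z"
proof -
  have "(y, z) \<in> (geom_gen K d \<union> (geom_gen K d)\<inverse>)\<^sup>*"
    using assms by (simp add: geom_eq_def)
  then show ?thesis
    by induction (auto dest: geom_phase_gen)
qed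

lemma equiv_geom_eq: "equiv (topspace (geom_pre K)) (geom_eq K d)"
proof (rule equivI)
  have "sym ((geom_gen K d \<union> (geom_gen K d)\<inverse>)\<^sup>*)"
    by (intro sym_rtrancl sym_Un_converse)
  then show "sym (geom_eq K d)"
    unfolding geom_eq_def by (auto simp: sym_def)
  show "trans (geom_eq K d)"
    unfolding geom_eq_def by (auto simp: trans_def)
qed (auto simp: geom_eq_def refl_on_def)

lemma geom_circle_class:
  assumes "C \<in> topspace (geom_pre K) // geom_eq K d" "z \<in> C"
  shows "geom_circle C = geom_phase z"
proof -
  have "(SOME z. z \<in> C) \<in> C"
    using assms by (auto intro: someI)
  then have "((SOME z. z \<in> C), z) \<in> geom_eq K d"
    using quotient_eq_iff [OF equiv_geom_eq assms(1) assms(1) _ assms(2)] by simp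
  then show ?thesis
    unfolding geom_circle_def by (rule geom_phase_eq)
qed

lemma topspace_cube_top [simp]: "topspace (cube_top n) = cube n"
  by (simp add: cube_top_def)

lemma topspace_geom_pre: "topspace (geom_pre K) = {(n, c, x). c \<in> K n \<and> x \<in> cube n}"
  by (auto simp: geom_pre_def)

lemma geom_circle_cell_map:
  assumes "c \<in> K n" "x \<in> cube n"
  shows "geom_circle (cell_map K d n c x) = cis (2 * pi * (\<Sum>i<n. x i))"
proof -
  have z: "(n, c, x) \<in> topspace (geom_pre K)"
    using assms by (simp add: topspace_geom_pre)
  have "geom_circle (cell_map K d n c x) = geom_phase (n, c, x)"
    unfolding cell_map_def
    by (rule geom_circle_class [OF quotientI [OF z] equiv_class_self [OF equiv_geom_eq z]])
  then show ?thesis by (simp add: geom_phase_def)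
qed

text \<open>Classes of an equivalence are disjoint, so taking the union of a set of classes commutes
  with intersection; this makes the defining predicate of \<open>quotient_top\<close> a
  topology.\<close>

lemma openin_quotient_top:
  assumes r: "equiv (topspace X) r"
  shows "openin (quotient_top X r) U \<longleftrightarrow> U \<subseteq> topspace X // r \<and> openin X (\<Union>U)"
proof -
  have Int: "\<Union>(S \<inter> T) = \<Union>S \<inter> \<Union>T" if "S \<subseteq> topspace X // r" "T \<subseteq> topspace X // r" for S T
    using that quotient_disj [OF r] by blast
  have Union: "\<Union>(\<Union>\<K>) = (\<Union>S\<in>\<K>. \<Union>S)" for \<K> :: "'a set set set"
    by blast
  have "istopology (\<lambda>U. U \<subseteq> topspace X // r \<and> openin X (\<Union>U))"
    unfolding istopology_def
  proof (intro conjI allI impI ballI)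
    fix \<K> assume "\<forall>S\<in>\<K>. S \<subseteq> topspace X // r \<and> openin X (\<Union>S)"
    then show "openin X (\<Union>(\<Union>\<K>))"
      unfolding Union by blast
  qed (auto simp: Int)
  then show ?thesis
    by (simp add: quotient_top_def)
qed

lemma topspace_geom: "topspace (geom K d) = topspace (geom_pre K) // geom_eq K d"
proof
  show "topspace (geom K d) \<subseteq> topspace (geom_pre K) // geom_eq K d"
    by (metis geom_def openin_quotient_top [OF equiv_geom_eq] openin_topspace)
  have "openin (geom K d) (topspace (geom_pre K) // geom_eq K d)"
    by (simp add: geom_def openin_quotient_top [OF equiv_geom_eq] Union_quotient [OF equiv_geom_eq])
  then show "topspace (geom_pre K) // geom_eq K d \<subseteq> topspace (geom K d)"
    by (rule openin_subset)
qed

lemma continuous_map_cube_coord: "continuous_map (cube_top n) euclideanreal (\<lambda>x. x i)"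
  unfolding cube_top_def
  by (intro continuous_map_from_subtopology continuous_map_product_projection) auto

lemma continuous_map_geom_phase: "continuous_map (geom_pre K) euclidean geom_phase"
  unfolding geom_pre_def
proof (rule continuous_map_from_sum_topology)
  fix n
  have "continuous_map (cube_top n) euclidean (\<lambda>x. cis (2 * pi * (\<Sum>i<n. x i)))"
    using continuous_map_cube_coord unfolding continuous_map_atin limitin_canonical_iff
    by (auto intro!: tendsto_intros)
  from continuous_map_compose [OF continuous_map_snd this]
  show "continuous_map (prod_topology (discrete_topology (K n)) (cube_top n)) euclidean
      (\<lambda>x. geom_phase (n, x))"
    by (simp add: geom_phase_def o_def case_prod_unfold)
qed

lemma continuous_map_geom_circle: "continuous_map (geom K d) euclidean geom_circle"
  unfolding continuous_map_def
proof (intro conjI allI impI)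
  fix U :: "complex set" assume U: "openin euclidean U"
  have "\<Union>{C \<in> topspace (geom K d). geom_circle C \<in> U}
      = {z \<in> topspace (geom_pre K). geom_phase z \<in> U}" (is "?A = ?B")
  proof
    show "?A \<subseteq> ?B"
      using in_quotient_imp_subset [OF equiv_geom_eq] geom_circle_class
      by (fastforce simp: topspace_geom)
    show "?B \<subseteq> ?A"
    proof
      fix z assume z: "z \<in> ?B"
      then have *: "geom_eq K d `` {z} \<in> topspace (geom K d)" "z \<in> geom_eq K d `` {z}"
        using equiv_class_self [OF equiv_geom_eq, of z K d] by (auto simp: topspace_geom intro: quotientI)
      then have "geom_circle (geom_eq K d `` {z}) = geom_phase z"
        by (intro geom_circle_class) (auto simp: topspace_geom)
      then show "z \<in> ?A"
        using * z by auto
    qed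
  qed
  then show "openin (geom K d) {C \<in> topspace (geom K d). geom_circle C \<in> U}"
    using openin_continuous_map_preimage [OF continuous_map_geom_phase U]
    by (auto simp: geom_def openin_quotient_top [OF equiv_geom_eq] simp flip: topspace_geom)
qed auto

section \<open>Arc length and reparametrization\<close>

definition moore_length :: "nat \<Rightarrow> (nat \<Rightarrow> real) \<Rightarrow> (nat \<Rightarrow> nat)
     \<Rightarrow> (nat \<Rightarrow> real \<Rightarrow> nat \<Rightarrow> real) \<Rightarrow> real \<Rightarrow> real" where
  "moore_length p t ns gs u = (\<Sum>k<p. if u \<le> t k then 0
     else (\<Sum>i<ns k. gs k (min u (t (Suc k)) - t k) i - gs k 0 i))"

text \<open>The decomposition behind \<open>arclen\<close> is some decomposition of
  \<open>r\<close>, possibly different from the given one and possibly with pieces that are not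
  tame. The facts below are therefore proved for every \<open>moore_decomp\<close>.\<close>

lemma arclen_moore_length:
  assumes "moore_decomp K d l r p t ns cs gs"
  obtains p' t' ns' cs' gs' where "moore_decomp K d l r p' t' ns' cs' gs'"
    "arclen K d l r = moore_length p' t' ns' gs'"
proof -
  define D where "D = (SOME (p, t, ns, cs, gs). moore_decomp K d l r p t ns cs gs)"
  obtain p' t' ns' cs' gs' where D': "D = (p', t', ns', cs', gs')"
    by (cases D) auto
  have "case D of (p, t, ns, cs, gs) \<Rightarrow> moore_decomp K d l r p t ns cs gs"
    unfolding D_def by (rule someI [of _ "(p, t, ns, cs, gs)"]) (simp add: assms)
  then have "moore_decomp K d l r p' t' ns' cs' gs'"
    by (simp add: D')
  moreover have "arclen K d l r = moore_length p' t' ns' gs'"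
    by (intro ext) (simp add: arclen_def moore_length_def D' flip: D_def)
  ultimately show ?thesis by (rule that)
qed

lemma dpath_cube_mem: "dpath_cube n l g \<Longrightarrow> s \<in> {0..l} \<Longrightarrow> g s \<in> cube n"
  by (force simp: dpath_cube_def dest: continuous_map_funspace)

lemma dpath_cube_continuous_coord:
  assumes "dpath_cube n l g"
  shows "continuous_on {0..l} (\<lambda>s. g s i)"
proof -
  have "continuous_map (subtopology euclideanreal {0..l}) (cube_top n) g"
    using assms by (simp add: dpath_cube_def)
  from continuous_map_compose [OF this continuous_map_cube_coord [of n i]] show ?thesis
    by (simp add: o_def)
qed

lemma dpath_cube_mono: "dpath_cube n l g \<Longrightarrow> 0 \<le> s \<Longrightarrow> s \<le> t \<Longrightarrow> t \<le> l \<Longrightarrow> i < n \<Longrightarrow> g s i \<le> g t i"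
  by (simp add: dpath_cube_def)

context
  fixes K :: "nat \<Rightarrow> 'a set" and d l r p t ns cs gs
  assumes md: "moore_decomp K d l r p t ns cs gs"
begin

lemma moore_knots_mono: "i \<le> j \<Longrightarrow> j \<le> p \<Longrightarrow> t i \<le> t j"
proof (induction j)
  case (Suc j)
  then have "t j \<le> t (Suc j)"
    using md by (simp add: moore_decomp_def less_imp_le)
  with Suc show ?case
    by (cases "i = Suc j") auto
qed simp

lemma moore_knots_bounds:
  assumes "k < p"
  shows "0 \<le> t k" "t k < t (Suc k)" "t (Suc k) \<le> l"
  using md moore_knots_mono [of 0 k] moore_knots_mono [of "Suc k" p] assms
  by (auto simp: moore_decomp_def)

lemma moore_dpath: "k < p \<Longrightarrow> dpath_cube (ns k) (t (Suc k) - t k) (gs k)"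
  using md by (simp add: moore_decomp_def)

lemma moore_path_eq:
  "k < p \<Longrightarrow> s \<in> {t k..t (Suc k)} \<Longrightarrow> r s = cell_map K d (ns k) (cs k) (gs k (s - t k))"
  using md by (simp add: moore_decomp_def)

definition piece_length :: "nat \<Rightarrow> real \<Rightarrow> real" where
  "piece_length k s = (\<Sum>i<ns k. gs k (s - t k) i - gs k 0 i)"

text \<open>Clamping \<open>u\<close> to the interval of each piece removes the case distinction: a
  piece not yet reached is evaluated at its start, where its length is 0. Continuity and
  monotonicity can then be proved summand by summand.\<close>

lemma moore_length_eq:
  "moore_length p t ns gs u = (\<Sum>k<p. piece_length k (max (t k) (min u (t (Suc k)))))"
  unfolding moore_length_def
proof (intro sum.cong refl)
  fix k assume "k \<in> {..<p}"
  then show "(if u \<le> t k then 0 else (\<Sum>i<ns k. gs k (min u (t (Suc k)) - t k) i - gs k 0 i))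
      = piece_length k (max (t k) (min u (t (Suc k))))"
    using moore_knots_bounds [of k] by (auto simp: piece_length_def max_def min_def)
qed

lemma piece_length_mono:
  assumes "k < p" "t k \<le> s" "s \<le> s'" "s' \<le> t (Suc k)"
  shows "piece_length k s \<le> piece_length k s'"
  unfolding piece_length_def
  using assms dpath_cube_mono [OF moore_dpath] by (intro sum_mono diff_right_mono) auto

lemma piece_length_clamp_mono:
  assumes "k < p" "u \<le> v"
  shows "piece_length k (max (t k) (min u (t (Suc k)))) \<le> piece_length k (max (t k) (min v (t (Suc k))))"
  using assms moore_knots_bounds [of k] by (intro piece_length_mono) (auto simp: max_def min_def)

lemma piece_length_continuous:
  assumes "k < p"
  shows "continuous_on UNIV (\<lambda>u. piece_length k (max (t k) (min u (t (Suc k)))))"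
proof -
  have "continuous_on UNIV (\<lambda>u. gs k (max (t k) (min u (t (Suc k))) - t k) i)" for i
    using moore_knots_bounds [OF assms]
    by (intro continuous_on_compose2 [OF dpath_cube_continuous_coord [OF moore_dpath [OF assms]]]
        continuous_intros) auto
  then show ?thesis
    unfolding piece_length_def by (intro continuous_intros)
qed

lemma moore_length_continuous: "continuous_on S (moore_length p t ns gs)"
proof -
  have "continuous_on UNIV (moore_length p t ns gs)"
    unfolding moore_length_eq by (intro continuous_on_sum piece_length_continuous) auto
  then show ?thesis
    by (rule continuous_on_subset) simp
qed

lemma moore_length_0: "moore_length p t ns gs 0 = 0"
  unfolding moore_length_def using moore_knots_bounds by (intro sum.neutral) auto

lemma moore_length_mono: "u \<le> v \<Longrightarrow> moore_length p t ns gs u \<le> moore_length p t ns gs v"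
  unfolding moore_length_eq by (intro sum_mono piece_length_clamp_mono) auto

lemma cis_piece_length:
  assumes "k < p" "s \<in> {t k..t (Suc k)}"
  shows "cis (2 * pi * piece_length k s) = geom_circle (r s) / geom_circle (r (t k))"
    and "geom_circle (r s) \<noteq> 0"
proof -
  have q: "geom_circle (r s) = cis (2 * pi * (\<Sum>i<ns k. gs k (s - t k) i))"
    if "s \<in> {t k..t (Suc k)}" for s
    unfolding moore_path_eq [OF assms(1) that]
  proof (rule geom_circle_cell_map)
    show "cs k \<in> K (ns k)"
      using md assms by (simp add: moore_decomp_def)
    show "gs k (s - t k) \<in> cube (ns k)"
      using that by (intro dpath_cube_mem [OF moore_dpath [OF assms(1)]]) auto
  qed
  show "geom_circle (r s) \<noteq> 0"
    by (simp add: q [OF assms(2)])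
  show "cis (2 * pi * piece_length k s) = geom_circle (r s) / geom_circle (r (t k))"
    using q [OF assms(2)] q [of "t k"] moore_knots_bounds(2) [OF assms(1)]
    by (simp add: cis_divide piece_length_def sum_subtractf right_diff_distrib)
qed

text \<open>The phases of the pieces multiply and telescope. Consecutive pieces may use unrelated
  cube coordinates, but at their common knot both describe the same point of \<open>r\<close>, and
  \<open>geom_circle\<close> sees only that point.\<close>

lemma cis_moore_length:
  assumes u: "u \<in> {0..l}"
  shows "cis (2 * pi * moore_length p t ns gs u) = geom_circle (r u) / geom_circle (r 0)"
proof -
  have p: "1 \<le> p" "t 0 = 0" "t p = l"
    using md by (auto simp: moore_decomp_def)
  then have r0: "geom_circle (r 0) \<noteq> 0"
    using cis_piece_length(2) [of 0 0] moore_knots_bounds [of 0] by simp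
  have "cis (2 * pi * (\<Sum>k<m. piece_length k (max (t k) (min u (t (Suc k))))))
      = geom_circle (r (min u (t m))) / geom_circle (r 0)" if "m \<le> p" for m
    using that
  proof (induction m)
    case 0
    then show ?case using u p r0 by simp
  next
    case (Suc m)
    let ?c = "max (t m) (min u (t (Suc m)))"
    have m: "m < p" "t m < t (Suc m)"
      using Suc moore_knots_bounds [of m] by auto
    have "geom_circle (r (t m)) \<noteq> 0"
      using m by (intro cis_piece_length(2) [OF m(1)]) auto
    \<comment> \<open>If \<open>u\<close> is at most \<open>t m\<close>, piece \<open>m\<close>
      contributes the factor 1 and both \<open>min\<close> times are \<open>u\<close>; otherwise the
      product so far ends exactly at \<open>t m\<close> and cancels the denominator.\<close>
    moreover have "?c = (if u \<le> t m then t m else min u (t (Suc m)))"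
        "min u (t m) = (if u \<le> t m then min u (t (Suc m)) else t m)"
      using m by auto
    ultimately have step: "geom_circle (r (min u (t m))) * (geom_circle (r ?c) / geom_circle (r (t m)))
        = geom_circle (r (min u (t (Suc m))))"
      by (auto split: if_splits)
    have "cis (2 * pi * piece_length m ?c) = geom_circle (r ?c) / geom_circle (r (t m))"
      using m by (intro cis_piece_length(1) [OF m(1)]) auto
    then have "cis (2 * pi * (\<Sum>k<Suc m. piece_length k (max (t k) (min u (t (Suc k))))))
        = geom_circle (r (min u (t m))) / geom_circle (r 0)
          * (geom_circle (r ?c) / geom_circle (r (t m)))"
      using Suc by (simp add: distrib_left flip: cis_mult)
    then show ?case
      by (simp add: flip: step)
  qed
  from this [of p] show ?thesis
    using u p by (simp add: moore_length_eq min_absorb1)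
qed

text \<open>A sum of nondecreasing terms is unchanged only if every term is. This is applied first
  to the pieces and then to the coordinates of the piece containing \<open>u\<close>, so the path
  stands still until \<open>v\<close> or the end of that piece, whichever comes first. Regularity
  already excludes this shorter interval.\<close>

lemma moore_length_eq_imp_constant:
  assumes uv: "0 \<le> u" "u < v" "v \<le> l"
    and eq: "moore_length p t ns gs u = moore_length p t ns gs v"
  obtains b where "u < b" "b \<le> v" "\<And>s. s \<in> {u..b} \<Longrightarrow> r s = r u"
proof -
  have p: "t 0 = 0" "t p = l"
    using md by (auto simp: moore_decomp_def)
  \<comment> \<open>\<open>t j\<close> is the first knot after \<open>u\<close>, so piece
    \<open>k\<close> starts no later than \<open>u\<close> and continues strictly beyond it.\<close>
  define j where "j = (LEAST j. u < t j)"
  have "u < t p" using uv p by simp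
  then have j: "u < t j" "j \<le> p"
    unfolding j_def by (auto intro: LeastI Least_le)
  then obtain k where k: "j = Suc k"
    using uv p by (cases j) auto
  have kp: "k < p" "t k \<le> u" "u < t (Suc k)"
    using j k not_less_Least [of k "\<lambda>j. u < t j"] by (auto simp: j_def)
  define b where "b = min v (t (Suc k))"
  have b: "u < b" "b \<le> v" "b \<le> t (Suc k)"
    using kp uv by (auto simp: b_def)
  have "piece_length k (max (t k) (min u (t (Suc k)))) = piece_length k (max (t k) (min v (t (Suc k))))"
    by (rule sum_mono_inv [OF eq [unfolded moore_length_eq]])
      (use uv kp in \<open>auto intro: piece_length_clamp_mono\<close>)
  then have "piece_length k u = piece_length k b"
    using kp b by (simp add: b_def [symmetric] max_absorb2)
  then have sum_eq: "(\<Sum>i<ns k. gs k (u - t k) i) = (\<Sum>i<ns k. gs k (b - t k) i)"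
    by (simp add: piece_length_def sum_subtractf)
  have ub: "gs k (u - t k) i = gs k (b - t k) i" if "i < ns k" for i
    by (rule sum_mono_inv [OF sum_eq])
      (use that kp b in \<open>auto intro!: dpath_cube_mono [OF moore_dpath [OF kp(1)]]\<close>)
  have "r s = r u" if s: "s \<in> {u..b}" for s
  proof -
    have "gs k (s - t k) i = gs k (u - t k) i" for i
    proof (cases "i < ns k")
      case True
      have "gs k (u - t k) i \<le> gs k (s - t k) i" "gs k (s - t k) i \<le> gs k (b - t k) i"
        using s kp b True by (auto intro!: dpath_cube_mono [OF moore_dpath [OF kp(1)]])
      then show ?thesis
        using ub [OF True] by simp
    next
      case False
      \<comment> \<open>Coordinates beyond the dimension are 0 by the encoding of
        \<open>cube\<close>.\<close>
      have "gs k (s - t k) \<in> cube (ns k)" "gs k (u - t k) \<in> cube (ns k)"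
        using s kp b by (auto intro!: dpath_cube_mem [OF moore_dpath [OF kp(1)]])
      then show ?thesis
        using False by (simp add: cube_def)
    qed
    then have "gs k (s - t k) = gs k (u - t k)"
      by blast
    then show ?thesis
      using s kp b by (simp add: moore_path_eq [OF kp(1)])
  qed
  with b show ?thesis using that by blast
qed

end

text \<open>All later reasoning about \<open>arclen\<close> rests on these four facts: it is the
  continuous lift, starting at 0, of the phase of \<open>r\<close> relative to its start, and
  regularity makes it strictly increasing.\<close>

lemma tame_dpath_arclen:
  assumes "tame_dpath K d l r"
  shows "continuous_on {0..l} (arclen K d l r)"
    and "arclen K d l r 0 = 0"
    and "\<And>u. u \<in> {0..l} \<Longrightarrow>
      cis (2 * pi * arclen K d l r u) = geom_circle (r u) / geom_circle (r 0)"
    and "regular_path l r \<Longrightarrow> strict_mono_on {0..l} (arclen K d l r)"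
proof -
  obtain p t ns cs gs where md: "moore_decomp K d l r p t ns cs gs"
    and L: "arclen K d l r = moore_length p t ns gs"
    using assms arclen_moore_length unfolding tame_dpath_def by metis
  show "continuous_on {0..l} (arclen K d l r)" "arclen K d l r 0 = 0"
    and "\<And>u. u \<in> {0..l} \<Longrightarrow>
      cis (2 * pi * arclen K d l r u) = geom_circle (r u) / geom_circle (r 0)"
    unfolding L using moore_length_continuous [OF md] moore_length_0 [OF md] cis_moore_length [OF md]
    by auto
  show "strict_mono_on {0..l} (arclen K d l r)" if reg: "regular_path l r"
    unfolding L
  proof (rule strict_mono_onI)
    fix u v assume uv: "u \<in> {0..l}" "v \<in> {0..l}" "u < v"
    have "moore_length p t ns gs u \<noteq> moore_length p t ns gs v"
    proof
      assume "moore_length p t ns gs u = moore_length p t ns gs v"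
      then obtain b where "u < b" "b \<le> v" "\<And>s. s \<in> {u..b} \<Longrightarrow> r s = r u"
        using moore_length_eq_imp_constant [OF md, of u v] uv by auto
      moreover have "0 \<le> u" "b \<le> l"
        using uv \<open>b \<le> v\<close> by auto
      ultimately show False
        using reg unfolding regular_path_def by blast
    qed
    then show "moore_length p t ns gs u < moore_length p t ns gs v"
      using moore_length_mono [OF md, of u v] uv by simp
  qed
qed

text \<open>These are the homeomorphisms of \<open>G_set\<close> freed from
  \<open>extensional\<close>, so that the notion also covers the unrestricted functions
  \<open>arclen K d l r\<close> and \<open>inv_into {0..l} f\<close>.\<close>

definition reparametrization :: "real \<Rightarrow> real \<Rightarrow> (real \<Rightarrow> real) \<Rightarrow> bool" where
  "reparametrization l l' f \<longleftrightarrow>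
     continuous_on {0..l} f \<and> strict_mono_on {0..l} f \<and> f 0 = 0 \<and> f l = l'"

context
  fixes l l' f
  assumes rp: "reparametrization l l' f" and l: "0 \<le> l"
begin

lemma reparametrization_bij: "bij_betw f {0..l} {0..l'}"
  unfolding bij_betw_def
proof
  have f: "continuous_on {0..l} f" "strict_mono_on {0..l} f" "f 0 = 0" "f l = l'"
    using rp by (auto simp: reparametrization_def)
  show "inj_on f {0..l}"
    using f(2) by (rule strict_mono_on_imp_inj_on)
  have "f s \<in> {0..l'}" if "s \<in> {0..l}" for s
    using strict_mono_on_leD [OF f(2), of 0 s] strict_mono_on_leD [OF f(2), of s l] that f l by auto
  moreover have "s \<in> f ` {0..l}" if "s \<in> {0..l'}" for s
    using IVT' [of f 0 s l] f l that by fastforce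
  ultimately show "f ` {0..l} = {0..l'}"
    by blast
qed

lemma reparametrization_range: "s \<in> {0..l} \<Longrightarrow> f s \<in> {0..l'}"
  using reparametrization_bij by (auto simp: bij_betw_def)

lemma reparametrization_inv_range: "s \<in> {0..l'} \<Longrightarrow> inv_into {0..l} f s \<in> {0..l}"
  using reparametrization_bij by (metis bij_betw_def inv_into_into)

lemma reparametrization_right_inv: "s \<in> {0..l'} \<Longrightarrow> f (inv_into {0..l} f s) = s"
  using reparametrization_bij by (metis bij_betw_inv_into_right)

lemma reparametrization_left_inv: "s \<in> {0..l} \<Longrightarrow> inv_into {0..l} f (f s) = s"
  using reparametrization_bij by (metis bij_betw_inv_into_left)

lemma reparametrization_inv: "reparametrization l' l (inv_into {0..l} f)"
  unfolding reparametrization_def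
proof (intro conjI)
  have f: "continuous_on {0..l} f" "strict_mono_on {0..l} f" "f 0 = 0" "f l = l'"
    using rp by (auto simp: reparametrization_def)
  show "inv_into {0..l} f 0 = 0" "inv_into {0..l} f l' = l"
    using reparametrization_left_inv [of 0] reparametrization_left_inv [of l] f l by auto
  have "continuous_on (f ` {0..l}) (inv_into {0..l} f)"
    using f reparametrization_left_inv by (intro continuous_on_inv) auto
  then show "continuous_on {0..l'} (inv_into {0..l} f)"
    using reparametrization_bij by (simp add: bij_betw_def)
  show "strict_mono_on {0..l'} (inv_into {0..l} f)"
    using strict_mono_on_less [OF f(2) reparametrization_inv_range reparametrization_inv_range]
    by (intro strict_mono_onI) (metis reparametrization_right_inv)
qed

lemma tame_dpath_reparam:
  assumes g: "tame_dpath K d l' g" and r: "\<And>s. s \<in> {0..l} \<Longrightarrow> r s = g (f s)"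
  shows "tame_dpath K d l r"
proof -
  obtain p t ns cs gs where md: "moore_decomp K d l' g p t ns cs gs"
    and tame: "\<And>k. k < p \<Longrightarrow> tame_cube (ns k) (t (Suc k) - t k) (gs k)"
    using g by (auto simp: tame_dpath_def)
  define h where "h = inv_into {0..l} f"
  have rh: "reparametrization l' l h"
    unfolding h_def by (rule reparametrization_inv)
  \<comment> \<open>Knots are pulled back by the inverse \<open>h\<close>. Local time
    \<open>s\<close> of the new piece is shifted to global time, moved by \<open>f\<close>, and
    shifted back by the old knot; the end values of each piece are unchanged, so tameness
    survives.\<close>
  define gs' where "gs' = (\<lambda>k s. gs k (f (s + h (t k)) - t k))"
  have f: "continuous_on {0..l} f" "strict_mono_on {0..l} f"
    using rp by (auto simp: reparametrization_def)
  have t: "t k \<in> {0..l'}" "t (Suc k) \<in> {0..l'}" "t k < t (Suc k)" if "k < p" for k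
    using moore_knots_bounds [OF md that] by auto
  have ht: "h (t k) \<in> {0..l}" "h (t (Suc k)) \<in> {0..l}" "h (t k) < h (t (Suc k))"
      "f (h (t k)) = t k" "f (h (t (Suc k))) = t (Suc k)" if "k < p" for k
    using t [OF that] reparametrization_inv_range reparametrization_right_inv rh
    by (auto simp: h_def reparametrization_def strict_mono_onD)
  have fle: "f s \<le> f s'" if "s \<in> {0..l}" "s' \<in> {0..l}" "s \<le> s'" for s s'
    using strict_mono_on_leD [OF f(2)] that by blast
  have shift: "s + h (t k) \<in> {0..l}" "f (s + h (t k)) \<in> {t k..t (Suc k)}"
    if "k < p" "s \<in> {0..h (t (Suc k)) - h (t k)}" for k s
  proof -
    show *: "s + h (t k) \<in> {0..l}"
      using ht [OF that(1)] that(2) by auto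
    show "f (s + h (t k)) \<in> {t k..t (Suc k)}"
      using fle [OF ht(1) *] fle [OF * ht(2)] ht(4,5) that by auto
  qed
  have "dpath_cube (ns k) (h (t (Suc k)) - h (t k)) (gs' k)" if k: "k < p" for k
    unfolding dpath_cube_def
  proof (intro conjI allI impI)
    have g: "continuous_map (subtopology euclideanreal {0..t (Suc k) - t k}) (cube_top (ns k)) (gs k)"
      using moore_dpath [OF md k] by (simp add: dpath_cube_def)
    have "continuous_on {0..h (t (Suc k)) - h (t k)} (\<lambda>s. f (s + h (t k)) - t k)"
      using ht [OF k] by (intro continuous_intros continuous_on_compose2 [OF f(1)]) auto
    then have "continuous_map (subtopology euclideanreal {0..h (t (Suc k)) - h (t k)})
        (subtopology euclideanreal {0..t (Suc k) - t k}) (\<lambda>s. f (s + h (t k)) - t k)"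
      using shift [OF k] by (auto simp: continuous_map_in_subtopology)
    from continuous_map_compose [OF this g]
    show "continuous_map (subtopology euclideanreal {0..h (t (Suc k)) - h (t k)}) (cube_top (ns k)) (gs' k)"
      by (simp add: gs'_def o_def)
    fix s s' i assume s: "0 \<le> s \<and> s \<le> s' \<and> s' \<le> h (t (Suc k)) - h (t k) \<and> i < ns k"
    then have "f (s + h (t k)) \<le> f (s' + h (t k))"
      using shift(1) [OF k, of s] shift(1) [OF k, of s'] by (intro fle) auto
    then show "gs' k s i \<le> gs' k s' i"
      unfolding gs'_def using s shift(2) [OF k, of s] shift(2) [OF k, of s']
      by (intro dpath_cube_mono [OF moore_dpath [OF md k]]) auto
  qed
  moreover have "r s = cell_map K d (ns k) (cs k) (gs' k (s - h (t k)))"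
    if k: "k < p" and s: "s \<in> {h (t k)..h (t (Suc k))}" for k s
    using shift [OF k, of "s - h (t k)"] s moore_path_eq [OF md k, of "f s"] r [of s]
    by (simp add: gs'_def)
  moreover have "tame_cube (ns k) (h (t (Suc k)) - h (t k)) (gs' k)" if "k < p" for k
    using tame [OF that] ht [OF that] by (simp add: tame_cube_def gs'_def)
  moreover have "h (t 0) = 0" "h (t p) = l"
    using md rh by (auto simp: moore_decomp_def reparametrization_def)
  ultimately show ?thesis
    unfolding tame_dpath_def
    using md ht by (intro exI [of _ p] exI [of _ "h \<circ> t"] exI [of _ ns] exI [of _ cs] exI [of _ gs'])
      (auto simp: moore_decomp_def)
qed

lemma R_set_reparam:
  assumes g: "g \<in> R_set K d l' a b" and r: "r \<in> extensional {0..l}" "\<And>s. s \<in> {0..l} \<Longrightarrow> r s = g (f s)"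
  shows "r \<in> R_set K d l a b"
proof -
  have f: "strict_mono_on {0..l} f" "f 0 = 0" "f l = l'"
    using rp by (auto simp: reparametrization_def)
  have "regular_path l r"
    unfolding regular_path_def
  proof clarify
    fix x y assume xy: "0 \<le> x" "x < y" "y \<le> l" and eq: "\<forall>s\<in>{x..y}. r s = r x"
    have "g s = g (f x)" if s: "s \<in> {f x..f y}" for s
    proof -
      have s': "s \<in> {0..l'}"
        using s reparametrization_range [of x] reparametrization_range [of y] xy by auto
      let ?s = "inv_into {0..l} f s"
      have "?s \<in> {x..y}"
        using strict_mono_on_less_eq [OF f(1), of x ?s] strict_mono_on_less_eq [OF f(1), of ?s y]
          reparametrization_inv_range [OF s'] reparametrization_right_inv [OF s'] s xy by auto
      then have "r ?s = r x"
        using eq by blast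
      then show ?thesis
        using r reparametrization_inv_range [OF s'] reparametrization_right_inv [OF s'] xy by auto
    qed
    moreover have "0 \<le> f x" "f x < f y" "f y \<le> l'"
      using reparametrization_range [of x] reparametrization_range [of y] xy
        strict_mono_onD [OF f(1), of x y] by auto
    ultimately show False
      using g unfolding R_set_def regular_path_def by blast
  qed
  moreover have "nonconstant_path l r"
  proof -
    obtain s s' where s: "s \<in> {0..l'}" "s' \<in> {0..l'}" "g s \<noteq> g s'"
      using g unfolding R_set_def nonconstant_path_def by blast
    then show ?thesis
      unfolding nonconstant_path_def
      using r(2) reparametrization_inv_range reparametrization_right_inv by metis
  qed
  moreover have "tame_dpath K d l r"
    using g r(2) by (intro tame_dpath_reparam [of K d g r]) (auto simp: R_set_def)
  ultimately show ?thesis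
    using g r f l by (simp add: R_set_def)
qed

text \<open>Both sides lift the same circle-valued path and start at 0, so
  \<open>cis_lift_unique\<close> identifies them, whatever decompositions were chosen for
  \<open>r\<close> and for \<open>g\<close>.\<close>

lemma arclen_reparam:
  assumes g: "tame_dpath K d l' g" and r: "\<And>s. s \<in> {0..l} \<Longrightarrow> r s = g (f s)"
    and u: "u \<in> {0..l}"
  shows "arclen K d l r u = arclen K d l' g (f u)"
proof -
  have tr: "tame_dpath K d l r"
    using g r by (rule tame_dpath_reparam)
  have f: "continuous_on {0..l} f" "f 0 = 0"
    using rp by (auto simp: reparametrization_def)
  note G = tame_dpath_arclen [OF g] and R = tame_dpath_arclen [OF tr]
  show ?thesis
  proof (rule cis_lift_unique [of l _ "\<lambda>u. arclen K d l' g (f u)"])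
    show "continuous_on {0..l} (\<lambda>u. arclen K d l' g (f u))"
      using reparametrization_range by (intro continuous_on_compose2 [OF G(1) f(1)]) auto
    show "cis (2 * pi * arclen K d l r s) = cis (2 * pi * arclen K d l' g (f s))" if "s \<in> {0..l}" for s
      using R(3) [OF that] G(3) [OF reparametrization_range [OF that]] r [OF that] r [of 0] f l by simp
  qed (use R G f u in auto)
qed

end

text \<open>Both end points are vertices and have phase 1, so the total length is an integer; strict
  increase from 0 makes it positive, which matches a coproduct starting at 1.\<close>

lemma R_set_arclen:
  assumes r: "r \<in> R_set K d l a b" and a: "a \<in> K 0" and b: "b \<in> K 0" and l: "0 < l"
  obtains n :: nat where "1 \<le> n" "real n = arclen K d l r l"
    "reparametrization l (real n) (arclen K d l r)"
proof -
  have tame: "tame_dpath K d l r" and reg: "regular_path l r"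
    and ends: "r 0 = vertex_pt K d a" "r l = vertex_pt K d b"
    using r by (auto simp: R_set_def)
  note L = tame_dpath_arclen [OF tame]
  have "geom_circle (vertex_pt K d v) = 1" if "v \<in> K 0" for v
    unfolding vertex_pt_def using that by (subst geom_circle_cell_map) (auto simp: cube_def)
  then have "cis (2 * pi * arclen K d l r l) = 1"
    using L(3) [of l] ends a b l by simp
  then have "cos (2 * pi * arclen K d l r l) = 1"
    by (metis cis.simps(1) one_complex.simps(1))
  then obtain k :: int where "2 * pi * arclen K d l r l = of_int k * 2 * pi"
    using cos_one_2pi_int by blast
  then have k: "arclen K d l r l = of_int k"
    by simp
  have "0 < arclen K d l r l"
    using strict_mono_onD [OF L(4) [OF reg], of 0 l] l L(2) by simp
  then have "real (nat k) = arclen K d l r l" "1 \<le> nat k"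
    using k by auto
  then show ?thesis
    using that L reg by (auto simp: reparametrization_def)
qed

section \<open>Naturalization\<close>

lemma reparametrization_homeomorphic_map:
  assumes f: "reparametrization l l' f" and l: "0 \<le> l"
  shows "homeomorphic_map (subtopology euclideanreal {0..l}) (subtopology euclideanreal {0..l'}) f"
  unfolding homeomorphic_map_maps homeomorphic_maps_def
  using f reparametrization_inv [OF f l] reparametrization_range [OF f l]
    reparametrization_inv_range [OF f l] reparametrization_left_inv [OF f l]
    reparametrization_right_inv [OF f l]
  by (intro exI [of _ "inv_into {0..l} f"])
    (auto simp: reparametrization_def continuous_map_in_subtopology)

lemma homeomorphic_map_reparametrization:
  assumes f: "homeomorphic_map (subtopology euclideanreal {0..l}) (subtopology euclideanreal {0..l'}) f"
    and mono: "mono_on {0..l} f" and l: "0 \<le> l" "0 \<le> l'"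
  shows "reparametrization l l' f"
proof -
  have cont: "continuous_on {0..l} f"
    using homeomorphic_imp_continuous_map [OF f] by (simp add: continuous_map_in_subtopology)
  have inj: "inj_on f {0..l}" and surj: "f ` {0..l} = {0..l'}"
    using homeomorphic_imp_injective_map [OF f] homeomorphic_imp_surjective_map [OF f] by auto
  have smono: "strict_mono_on {0..l} f"
  proof (rule strict_mono_onI)
    fix x y assume xy: "x \<in> {0..l}" "y \<in> {0..l}" "x < y"
    then have "f x \<noteq> f y"
      using inj by (auto dest: inj_onD)
    then show "f x < f y"
      using mono_onD [OF mono, of x y] xy by simp
  qed
  have range: "f s \<in> {0..l'}" if "s \<in> {0..l}" for s
    using surj that by blast
  have "0 \<in> f ` {0..l}" "l' \<in> f ` {0..l}"
    using surj l by auto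
  then obtain x y where x: "x \<in> {0..l}" "f x = 0" and y: "y \<in> {0..l}" "f y = l'"
    by auto
  have "f 0 = 0"
    using mono_onD [OF mono, of 0 x] x range [of 0] l by auto
  moreover have "f l = l'"
    using mono_onD [OF mono, of y l] y range [of l] l by auto
  ultimately show ?thesis
    using cont smono by (simp add: reparametrization_def)
qed

lemma G_set_iff:
  assumes "0 < l"
  shows "f \<in> G_set l n \<longleftrightarrow> f \<in> extensional {0..l} \<and> reparametrization l (real n) f"
proof -
  have "mono_on {0..l} f" if "reparametrization l (real n) f"
    using that unfolding reparametrization_def by (metis strict_mono_on_imp_mono_on)
  then show ?thesis
    unfolding G_set_def
    using assms homeomorphic_map_reparametrization [of l "real n" f]
      reparametrization_homeomorphic_map [of l "real n" f] by force
qed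

lemma reparametrization_continuous_map:
  assumes "reparametrization l l' f" "0 \<le> l"
  shows "continuous_map (subtopology euclideanreal {0..l}) (subtopology euclideanreal {0..l'}) f"
  using reparametrization_homeomorphic_map [OF assms] by (rule homeomorphic_imp_continuous_map)

lemma topspace_G_top:
  assumes "0 < l"
  shows "f \<in> topspace (G_top l n) \<longleftrightarrow> f \<in> extensional {0..l} \<and> reparametrization l (real n) f"
  using assms reparametrization_continuous_map [of l "real n" f]
  by (auto simp: G_top_def G_set_iff cmaps_def)

text \<open>Continuity comes from the ambient path space, since the definition of
  \<open>R_set\<close> does not state it; hence the intersection.\<close>

lemma topspace_R_top:
  "topspace (R_top K d l a b) = cmaps (subtopology euclideanreal {0..l}) (geom K d) \<inter> R_set K d l a b"
  by (simp add: R_top_def path_top_def)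

lemma topspace_N_top:
  "topspace (N_top K d n a b) = topspace (R_top K d (real n) a b) \<inter> N_set K d n a b"
  by (simp add: N_top_def)

lemma continuous_map_simplex_R_top:
  "continuous_map (simplex_top m) (R_top K d l a b) \<sigma> \<longleftrightarrow>
    continuous_map (prod_topology (simplex_top m) (subtopology euclideanreal {0..l})) (geom K d)
      (\<lambda>(x, t). \<sigma> x t) \<and> (\<forall>x \<in> standard_simplex m. \<sigma> x \<in> R_set K d l a b)"
  by (auto simp: R_top_def path_top_def continuous_map_in_subtopology continuous_map_co_top_interval
      R_set_def)

lemma continuous_map_simplex_N_top:
  "continuous_map (simplex_top m) (N_top K d n a b) \<sigma> \<longleftrightarrow>
    continuous_map (prod_topology (simplex_top m) (subtopology euclideanreal {0..real n})) (geom K d)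
      (\<lambda>(x, t). \<sigma> x t) \<and> (\<forall>x \<in> standard_simplex m. \<sigma> x \<in> N_set K d n a b)"
  by (auto simp: N_top_def continuous_map_in_subtopology continuous_map_simplex_R_top N_set_def)

text \<open>The target is written as the whole line because \<open>reparametrization\<close> already
  confines the values to \<open>{0..real n}\<close>.\<close>

lemma continuous_map_simplex_G_top:
  assumes "0 < l"
  shows "continuous_map (simplex_top m) (G_top l n) \<sigma> \<longleftrightarrow>
    continuous_map (prod_topology (simplex_top m) (subtopology euclideanreal {0..l})) euclideanreal
      (\<lambda>(x, t). \<sigma> x t) \<and>
    (\<forall>x \<in> standard_simplex m. \<sigma> x \<in> extensional {0..l} \<and> reparametrization l (real n) (\<sigma> x))"
  using assms reparametrization_range [of l "real n"]
  by (auto simp: G_top_def continuous_map_in_subtopology continuous_map_co_top_interval G_set_iff)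

text \<open>Ending the domain at the total length, rather than at a given natural number, makes this
  a function of \<open>r\<close> alone.\<close>

definition naturalize :: "(nat \<Rightarrow> 'a set) \<Rightarrow> (nat \<Rightarrow> nat \<Rightarrow> bool \<Rightarrow> 'a \<Rightarrow> 'a) \<Rightarrow> real
     \<Rightarrow> (real \<Rightarrow> 'a gpt) \<Rightarrow> (real \<Rightarrow> 'a gpt)" where
  "naturalize K d l r = restrict (r \<circ> inv_into {0..l} (Lhat K d l r)) {0..arclen K d l r l}"

lemma reparametrization_Lhat:
  "reparametrization l l' (arclen K d l r) \<Longrightarrow> 0 \<le> l \<Longrightarrow> reparametrization l l' (Lhat K d l r)"
  unfolding reparametrization_def
  by (auto simp: Lhat_def strict_mono_on_def elim!: continuous_on_eq)

text \<open>Arc length commutes with reparametrization, so reading \<open>r\<close> along the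
  inverse of its own length function gives length \<open>s\<close> at time \<open>s\<close>.\<close>

lemma naturalize_in_N_set:
  assumes r: "r \<in> R_set K d l a b" and l: "0 < l" and n: "real n = arclen K d l r l"
    and rp: "reparametrization l (real n) (arclen K d l r)"
  shows "naturalize K d l r \<in> N_set K d n a b"
proof -
  let ?L = "Lhat K d l r"
  have L: "reparametrization l (real n) ?L"
    using rp l by (simp add: reparametrization_Lhat)
  have inv: "reparametrization (real n) l (inv_into {0..l} ?L)"
    using L l by (intro reparametrization_inv) auto
  have eq: "naturalize K d l r s = r (inv_into {0..l} ?L s)" if "s \<in> {0..real n}" for s
    using that n by (simp add: naturalize_def)
  have ext: "naturalize K d l r \<in> extensional {0..real n}"
    by (simp add: naturalize_def n)
  have "naturalize K d l r \<in> R_set K d (real n) a b"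
    by (rule R_set_reparam [OF inv _ r ext eq]) auto
  moreover have "arclen K d (real n) (naturalize K d l r) s = s" if s: "s \<in> {0..real n}" for s
  proof -
    have "tame_dpath K d l r"
      using r by (simp add: R_set_def)
    from arclen_reparam [OF inv _ this eq s]
    have "arclen K d (real n) (naturalize K d l r) s = arclen K d l r (inv_into {0..l} ?L s)"
      by simp
    also have "\<dots> = ?L (inv_into {0..l} ?L s)"
      using reparametrization_inv_range [OF L _ s] l by (simp add: Lhat_def)
    also have "\<dots> = s"
      using reparametrization_right_inv [OF L _ s] l by simp
    finally show ?thesis .
  qed
  ultimately show ?thesis
    by (simp add: N_set_def)
qed

text \<open>The image is connected, and two different integer values would put a half-integer into
  it. Applied to the total length, this keeps a whole simplex of paths in one summand.\<close>

lemma continuous_map_integer_constant: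
  assumes f: "continuous_map X euclideanreal f" and X: "connected_space X"
    and int: "\<And>x. x \<in> topspace X \<Longrightarrow> f x \<in> \<int>" and xy: "x \<in> topspace X" "y \<in> topspace X"
  shows "f x = f y"
proof (rule ccontr)
  assume "f x \<noteq> f y"
  have conn: "connected (f ` topspace X)"
    using connectedin_continuous_map_image [OF f, of "topspace X"] X by (simp add: connectedin_topspace)
  have no: False if "u \<in> f ` topspace X" "v \<in> f ` topspace X" "u < v" for u v
  proof -
    have "u \<in> \<int>" "v \<in> \<int>"
      using that int by auto
    then obtain i j :: int where ij: "u = of_int i" "v = of_int j"
      by (auto elim!: Ints_cases)
    then have "u + 1/2 \<in> f ` topspace X"
      using connected_contains_Icc [OF conn that(1,2)] that(3) by (auto simp: subset_iff)
    then have "u + 1/2 \<in> \<int>"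
      using int by (metis (no_types, lifting) image_iff)
    then have "of_int i + 1/2 \<in> (\<int> :: real set)"
      using ij by simp
    then obtain k :: int where "real_of_int i + 1/2 = real_of_int k"
      by (auto elim!: Ints_cases)
    then have "real_of_int (2 * i + 1) = real_of_int (2 * k)"
      by simp
    then have "2 * i + 1 = 2 * k"
      by (simp only: of_int_eq_iff)
    then show False
      by presburger
  qed
  show False
    using no [of "f x" "f y"] no [of "f y" "f x"] \<open>f x \<noteq> f y\<close> xy by fastforce
qed

section \<open>Composition and naturalization are continuous and mutually inverse\<close>

lemma continuous_map_reparam:
  assumes l: "0 < l"
  shows "continuous_map (src_top K d l a b) (R_top K d l a b) (reparam l)"
  unfolding src_top_def
proof (intro continuous_map_from_sum_topology continuous_map_from_dk)
  fix n m and \<sigma> :: "(nat \<Rightarrow> real) \<Rightarrow> (real \<Rightarrow> real) \<times> (real \<Rightarrow> 'a gpt)"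
  let ?S = "simplex_top m" and ?I = "\<lambda>l. subtopology euclideanreal {0..l}"
  assume "continuous_map ?S (prod_topology (G_top l n) (N_top K d n a b)) \<sigma>"
  then have \<sigma>: "continuous_map ?S (G_top l n) (\<lambda>x. fst (\<sigma> x))"
      "continuous_map ?S (N_top K d n a b) (\<lambda>x. snd (\<sigma> x))"
    by (auto simp: continuous_map_pairwise o_def)
  have f: "continuous_map (prod_topology ?S (?I l)) euclideanreal (\<lambda>z. fst (\<sigma> (fst z)) (snd z))"
    and rp: "\<And>x. x \<in> standard_simplex m \<Longrightarrow> reparametrization l (real n) (fst (\<sigma> x))"
    using \<sigma>(1) l by (auto simp: continuous_map_simplex_G_top case_prod_unfold)
  have g: "continuous_map (prod_topology ?S (?I (real n))) (geom K d) (\<lambda>z. snd (\<sigma> (fst z)) (snd z))"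
    and N: "\<And>x. x \<in> standard_simplex m \<Longrightarrow> snd (\<sigma> x) \<in> N_set K d n a b"
    using \<sigma>(2) by (auto simp: continuous_map_simplex_N_top case_prod_unfold)
  \<comment> \<open>The first probe only changes the time at which the second one is read, so joint
    continuity of both gives that of the composite.\<close>
  have "continuous_map (prod_topology ?S (?I l)) (prod_topology ?S (?I (real n)))
      (\<lambda>z. (fst z, fst (\<sigma> (fst z)) (snd z)))"
    using f rp l reparametrization_range [of l "real n"]
    by (auto intro!: continuous_map_pairedI continuous_map_fst simp: continuous_map_in_subtopology)
  from continuous_map_compose [OF this g]
  have "continuous_map (prod_topology ?S (?I l)) (geom K d)
      (\<lambda>z. snd (\<sigma> (fst z)) (fst (\<sigma> (fst z)) (snd z)))"
    by (simp add: o_def)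
  then have "continuous_map (prod_topology ?S (?I l)) (geom K d)
      (\<lambda>(x, t). reparam l (n, \<sigma> x) t)"
    by (rule continuous_map_eq) (auto simp: reparam_def case_prod_unfold)
  moreover have "reparam l (n, \<sigma> x) \<in> R_set K d l a b" if x: "x \<in> standard_simplex m" for x
  proof (rule R_set_reparam [OF rp [OF x]])
    show "snd (\<sigma> x) \<in> R_set K d (real n) a b"
      using N [OF x] by (simp add: N_set_def)
  qed (use l in \<open>auto simp: reparam_def case_prod_unfold\<close>)
  ultimately show "continuous_map ?S (R_top K d l a b) (\<lambda>x. reparam l (n, \<sigma> x))"
    by (simp add: continuous_map_simplex_R_top)
qed

text \<open>The total length is an integer, so the floor is exact and merely converts it to a
  natural number. On a probe this index is constant, hence the map factors through one summand,
  where its two components are treated separately.\<close>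

lemma continuous_map_naturalize:
  assumes a: "a \<in> K 0" and b: "b \<in> K 0" and l: "0 < l"
  shows "continuous_map (R_top K d l a b) (src_top K d l a b)
    (\<lambda>r. (nat \<lfloor>arclen K d l r l\<rfloor>, Lhat K d l r, naturalize K d l r))"
  unfolding R_top_def
proof (rule continuous_map_from_dk)
  fix m and \<sigma> :: "(nat \<Rightarrow> real) \<Rightarrow> real \<Rightarrow> 'a gpt"
  let ?S = "simplex_top m" and ?I = "\<lambda>l. subtopology euclideanreal {0..l}"
  let ?L = "\<lambda>x. arclen K d l (\<sigma> x)"
  assume "continuous_map ?S (subtopology (path_top K d l) (R_set K d l a b)) \<sigma>"
  then have "continuous_map ?S (R_top K d l a b) \<sigma>"
    by (simp add: R_top_def)
  then have H: "continuous_map (prod_topology ?S (?I l)) (geom K d) (\<lambda>z. \<sigma> (fst z) (snd z))"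
    and R: "\<And>x. x \<in> standard_simplex m \<Longrightarrow> \<sigma> x \<in> R_set K d l a b"
    by (auto simp: continuous_map_simplex_R_top case_prod_unfold)
  have tame: "tame_dpath K d l (\<sigma> x)" if "x \<in> standard_simplex m" for x
    using R [OF that] by (simp add: R_set_def)
  have L: "continuous_map (prod_topology ?S (?I l)) euclideanreal (\<lambda>(x, t). ?L x t)"
  proof (rule continuous_map_cis_lift)
    show "continuous_map (prod_topology ?S (?I l)) euclidean (geom_circle \<circ> (\<lambda>z. \<sigma> (fst z) (snd z)))"
      by (rule continuous_map_compose [OF H continuous_map_geom_circle])
    fix x t assume x: "x \<in> topspace ?S" and t: "t \<in> {0..l}"
    \<comment> \<open>The start is a vertex, of phase 1, so the ratio of phases in
      \<open>tame_dpath_arclen\<close> is simply the phase at time \<open>t\<close>.\<close>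
    have "\<sigma> x 0 = vertex_pt K d a"
      using R x by (simp add: R_set_def)
    moreover have "geom_circle (vertex_pt K d a) = 1"
      unfolding vertex_pt_def using a by (subst geom_circle_cell_map) (auto simp: cube_def)
    ultimately show "(geom_circle \<circ> (\<lambda>z. \<sigma> (fst z) (snd z))) (x, t) = cis (2 * pi * ?L x t)"
      using tame_dpath_arclen(3) [OF tame t] x by simp
  qed (auto intro: tame tame_dpath_arclen(1,2))
  obtain x0 where x0: "x0 \<in> standard_simplex m"
    using nonempty_standard_simplex by blast
  obtain n where n: "1 \<le> n" "real n = ?L x0 l"
    using R_set_arclen [OF R [OF x0] a b l] by metis
  have Ln: "?L x l = real n" if x: "x \<in> standard_simplex m" for x
    unfolding n(2)
  proof (rule continuous_map_integer_constant [where f = "\<lambda>x. ?L x l", OF _ connected_space_simplex_top])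
    have "continuous_map ?S (prod_topology ?S (?I l)) (\<lambda>x. (x, l))"
      using l by (simp add: continuous_map_pairedI)
    from continuous_map_compose [OF this L]
    show "continuous_map ?S euclideanreal (\<lambda>x. ?L x l)"
      by (simp add: o_def)
    show "?L x l \<in> \<int>" if "x \<in> topspace ?S" for x
      using R_set_arclen [OF R a b l, of x] that by (metis Ints_of_nat topspace_simplex_top)
  qed (use x x0 in auto)
  have rp: "reparametrization l (real n) (?L x)" if x: "x \<in> standard_simplex m" for x
    using R_set_arclen [OF R [OF x] a b l] Ln [OF x] by metis
  then have rp': "reparametrization l (real n) (Lhat K d l (\<sigma> x))" if x: "x \<in> standard_simplex m" for x
    using x l by (simp add: reparametrization_Lhat)
  have L': "continuous_map (prod_topology ?S (?I l)) euclideanreal (\<lambda>(x, t). Lhat K d l (\<sigma> x) t)"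
    by (rule continuous_map_eq [OF L]) (auto simp: Lhat_def)
  have G: "continuous_map ?S (G_top l n) (\<lambda>x. Lhat K d l (\<sigma> x))"
    using L' rp' l by (simp add: continuous_map_simplex_G_top) (simp add: Lhat_def)
  \<comment> \<open>Naturalization reads \<open>\<sigma> x\<close> at a time that itself depends on
    \<open>x\<close>, so the inverses are needed as a jointly continuous family.\<close>
  have inv: "continuous_map (prod_topology ?S (?I (real n))) (?I l)
      (\<lambda>(x, s). inv_into {0..l} (Lhat K d l (\<sigma> x)) s)"
  proof (rule continuous_map_inverse_reparam [OF L'])
    show "strict_mono_on {0..l} (Lhat K d l (\<sigma> x))" if "x \<in> topspace ?S" for x
      using rp' that by (simp add: reparametrization_def)
    show "inv_into {0..l} (Lhat K d l (\<sigma> x)) s \<in> {0..l} \<and>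
        Lhat K d l (\<sigma> x) (inv_into {0..l} (Lhat K d l (\<sigma> x)) s) = s"
      if "x \<in> topspace ?S" "s \<in> {0..real n}" for x s
      using reparametrization_inv_range [OF rp' _ that(2)] reparametrization_right_inv [OF rp' _ that(2)]
        that(1) l by simp
  qed
  then have "continuous_map (prod_topology ?S (?I (real n))) (prod_topology ?S (?I l))
      (\<lambda>z. (fst z, inv_into {0..l} (Lhat K d l (\<sigma> (fst z))) (snd z)))"
    by (intro continuous_map_pairedI continuous_map_fst) (simp add: case_prod_unfold)
  from continuous_map_compose [OF this H]
  have "continuous_map (prod_topology ?S (?I (real n))) (geom K d)
      (\<lambda>z. \<sigma> (fst z) (inv_into {0..l} (Lhat K d l (\<sigma> (fst z))) (snd z)))"
    by (simp add: o_def)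
  then have "continuous_map (prod_topology ?S (?I (real n))) (geom K d)
      (\<lambda>(x, s). naturalize K d l (\<sigma> x) s)"
    by (rule continuous_map_eq) (auto simp: naturalize_def Ln)
  then have "continuous_map ?S (N_top K d n a b) (\<lambda>x. naturalize K d l (\<sigma> x))"
    using naturalize_in_N_set [OF R l _ rp] Ln by (simp add: continuous_map_simplex_N_top)
  with G have "continuous_map ?S (dk (prod_topology (G_top l n) (N_top K d n a b)))
      (\<lambda>x. (Lhat K d l (\<sigma> x), naturalize K d l (\<sigma> x)))"
    by (simp add: continuous_map_pairedI)
  from continuous_map_compose [OF this, of "src_top K d l a b" "Pair n"]
  have "continuous_map ?S (src_top K d l a b)
      (\<lambda>x. (n, Lhat K d l (\<sigma> x), naturalize K d l (\<sigma> x)))"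
    using continuous_map_component_injection [of n "{1..}" "\<lambda>n. dk (prod_topology (G_top l n) (N_top K d n a b))"] n(1)
    by (simp add: src_top_def o_def)
  then show "continuous_map ?S (src_top K d l a b)
      (\<lambda>x. (nat \<lfloor>?L x l\<rfloor>, Lhat K d l (\<sigma> x), naturalize K d l (\<sigma> x)))"
    by (rule continuous_map_eq) (simp add: Ln)
qed

text \<open>A natural \<open>g\<close> has time itself as arc length, so by
  \<open>arclen_reparam\<close> the arc length of \<open>g\<close> after \<open>f\<close> is
  \<open>f\<close>. This recovers \<open>f\<close>, its end value \<open>n\<close>, and finally
  \<open>g\<close> by undoing \<open>f\<close>.\<close>

lemma naturalize_reparam:
  assumes z: "(n, f, g) \<in> topspace (src_top K d l a b)" and l: "0 < l"
  shows "arclen K d l (reparam l (n, f, g)) l = real n"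
    and "Lhat K d l (reparam l (n, f, g)) = f"
    and "naturalize K d l (reparam l (n, f, g)) = g"
proof -
  let ?r = "reparam l (n, f, g)"
  have f: "f \<in> extensional {0..l}" "reparametrization l (real n) f"
    and g: "g \<in> N_set K d n a b"
    using z l by (auto simp: src_top_def topspace_G_top topspace_N_top)
  have g': "tame_dpath K d (real n) g" "g \<in> extensional {0..real n}"
    using g by (auto simp: N_set_def R_set_def)
  have eq: "?r s = g (f s)" if "s \<in> {0..l}" for s
    using that by (simp add: reparam_def)
  have arc: "arclen K d l ?r s = f s" if s: "s \<in> {0..l}" for s
  proof -
    have "arclen K d l ?r s = arclen K d (real n) g (f s)"
      using l by (intro arclen_reparam [OF f(2) _ g'(1) eq s]) auto
    also have "\<dots> = f s"
      using g reparametrization_range [OF f(2) _ s] l by (simp add: N_set_def)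
    finally show ?thesis .
  qed
  then show n: "arclen K d l ?r l = real n"
    using l f by (simp add: reparametrization_def)
  show L: "Lhat K d l ?r = f"
    using arc f(1) by (auto simp: Lhat_def restrict_def extensional_def)
  show "naturalize K d l ?r = g"
  proof
    fix s
    show "naturalize K d l ?r s = g s"
    proof (cases "s \<in> {0..real n}")
      case True
      have "0 \<le> l"
        using l by simp
      then have "f (inv_into {0..l} f s) = s" "inv_into {0..l} f s \<in> {0..l}"
        using reparametrization_right_inv [OF f(2) _ True] reparametrization_inv_range [OF f(2) _ True] by auto
      then show ?thesis
        using True eq by (simp add: naturalize_def n L)
    next
      case False
      then show ?thesis
        using g'(2) by (auto simp: naturalize_def n L extensional_def)
    qed
  qed
qed

lemma reparam_naturalize:
  assumes r: "r \<in> R_set K d l a b" and a: "a \<in> K 0" and b: "b \<in> K 0" and l: "0 < l"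
  shows "reparam l (n, Lhat K d l r, naturalize K d l r) = r"
proof
  fix s
  \<comment> \<open>This \<open>n\<close> shadows the index of the statement, so the claim is shown
    for an arbitrary \<open>n'\<close>.\<close>
  obtain n where n: "real n = arclen K d l r l" "reparametrization l (real n) (arclen K d l r)"
    using R_set_arclen [OF r a b l] by metis
  have L: "reparametrization l (real n) (Lhat K d l r)"
    using n l by (simp add: reparametrization_Lhat)
  show "reparam l (n', Lhat K d l r, naturalize K d l r) s = r s" for n'
  proof (cases "s \<in> {0..l}")
    case True
    then show ?thesis
      using reparametrization_range [OF L _ True] reparametrization_left_inv [OF L _ True] l
      by (simp add: reparam_def naturalize_def flip: n(1))
  next
    case False
    then show ?thesis
      using r by (auto simp: reparam_def R_set_def extensional_def)
  qed
qed

theorem theorem4p9: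
  fixes K :: "nat \<Rightarrow> 'a set" and d :: "nat \<Rightarrow> nat \<Rightarrow> bool \<Rightarrow> 'a \<Rightarrow> 'a"
    and a b :: 'a and l :: real
  assumes "precubical K d" and "a \<in> K 0" and "b \<in> K 0" and "l > 0"
  shows "homeomorphic_map (src_top K d l a b) (R_top K d l a b) (reparam l) \<and>
    (\<forall>r\<in>topspace (R_top K d l a b). \<exists>n. real n = arclen K d l r l \<and>
       (n, Lhat K d l r, restrict (r \<circ> inv_into {0..l} (Lhat K d l r)) {0..real n})
          \<in> topspace (src_top K d l a b) \<and>
       reparam l (n, Lhat K d l r, restrict (r \<circ> inv_into {0..l} (Lhat K d l r)) {0..real n}) = r)"
proof (intro conjI ballI)
  let ?g = "\<lambda>r. (nat \<lfloor>arclen K d l r l\<rfloor>, Lhat K d l r, naturalize K d l r)"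
  note g = continuous_map_naturalize [of a K b l d, OF assms(2-4)]
  have inv: "reparam l (?g r) = r" if "r \<in> topspace (R_top K d l a b)" for r
    using that reparam_naturalize [of r K d l a b] assms by (simp add: topspace_R_top)
  have "homeomorphic_maps (src_top K d l a b) (R_top K d l a b) (reparam l) ?g"
    unfolding homeomorphic_maps_def
  proof (intro conjI ballI)
    fix z assume z: "z \<in> topspace (src_top K d l a b)"
    obtain n f h where "z = (n, f, h)"
      by (cases z) auto
    then show "?g (reparam l z) = z"
      using naturalize_reparam [of n f h K d l a b] z assms(4) by simp
  qed (use inv g continuous_map_reparam [OF assms(4)] in auto)
  then show "homeomorphic_map (src_top K d l a b) (R_top K d l a b) (reparam l)"
    by (rule homeomorphic_maps_imp_map)
  fix r assume r: "r \<in> topspace (R_top K d l a b)"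
  then obtain n :: nat where n: "real n = arclen K d l r l"
    using R_set_arclen [of r K d l a b] assms by (metis IntD2 topspace_R_top)
  have "?g r \<in> topspace (src_top K d l a b)"
    using continuous_map_funspace [OF g] r by blast
  \<comment> \<open>Rewriting the total length as \<open>real n\<close> evaluates the index in
    \<open>?g r\<close> to \<open>n\<close>, so both facts about \<open>?g r\<close> carry
    over.\<close>
  then have "(n, Lhat K d l r, naturalize K d l r) \<in> topspace (src_top K d l a b)"
      "reparam l (n, Lhat K d l r, naturalize K d l r) = r"
    using inv [OF r] by (simp_all flip: n)
  then show "\<exists>n. real n = arclen K d l r l \<and>
       (n, Lhat K d l r, restrict (r \<circ> inv_into {0..l} (Lhat K d l r)) {0..real n})
          \<in> topspace (src_top K d l a b) \<and>
       reparam l (n, Lhat K d l r, restrict (r \<circ> inv_into {0..l} (Lhat K d l r)) {0..real n}) = r"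
    by (intro exI [of _ n]) (simp add: naturalize_def flip: n)
qed

end
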